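(* Let $(X,d)$ be a (nonempty) compact metric space, $\alpha:X\to X$ a continuous map that is a local homeomorphism on $X_\alpha$ (i.e. $\alpha:X_\alpha\to X_\alpha$ is a local homeomorphism), and $a\in C(X)$ a positive function. Then $$P(\alpha,\ln a)-\gamma(\alpha)\ \le\ \ell(\alpha,a)\ \le\ P(\alpha,\ln a).$$
   Context: $M_\alpha(X)$ is the set of Borel $\alpha$-invariant probability measures on $X$. A point $x\in X$ is essential if every neighborhood $V$ of $x$ satisfies $\mu(V)>0$ for some $\mu\in M_\alpha(X)$; $X_\alpha$ is the (closed) set of essential points, and $\alpha(X_\alpha)=X_\alpha$. For $x\in X_\alpha$ put $\tilde\alpha^{-n}(x):=\alpha^{-n}(x)\cap X_\alpha$. A local homeomorphism is a map such that every point has an open neighborhood mapped homeomorphically onto an open set; on the compact space $X_\alpha$ this gives $\sup_{x\in X_\alpha}|\tilde\alpha^{-1}(x)|<\infty$. Put $d_n(x,y):=\max_{0\le i\le n-1}d(\alpha^i(x),\alpha^i(y))$. A set $E\subset X$ is $(n,\varepsilon)$-spanning if for every $x\in X$ there is $y\in E$ with $d_n(x,y)<\varepsilon$; a set $E\subset X_\alpha$ is $(n,\varepsilon)$-spanning for $X_\alpha$ if for every $x\in X_\alpha$ there is $y\in E$ with $d_n(x,y)<\varepsilon$. Topological pressure (for positive $a\in C(X)$): $$P(\alpha,\ln a):=\ln\lim_{\varepsilon\to0}\limsup_{n\to\infty}\inf\Bigl\{\Bigl(\sum_{y\in E}\prod_{i=0}^{n-1}a(\alpha^i(y))\Bigr)^{1/n}: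 E\text{ is }(n,\varepsilon)\text{-spanning}\Bigr\}.$$ Forward entropy: $\gamma(\alpha):=\ln\lim_{\varepsilon\to0}\limsup_{n\to\infty}\inf\{|\alpha^n(E)|^{1/n}: E\text{ is }(n,\varepsilon)\text{-spanning for }X_\alpha\}$. Essential spectral potential (for nonnegative $a$): $$\ell(\alpha,a):=\ln\lim_{n\to\infty}\sup_{x\in X_\alpha}\Bigl(\sum_{y\in\tilde\alpha^{-n}(x)}\prod_{i=0}^{n-1}a(\alpha^i(y))\Bigr)^{1/n},\qquad \ln0=-\infty.$$
   Formalization: The left inequality is stated only when P(α, ln a) and γ(α) are not both +∞, since otherwise the difference P − γ is undefined (e.g. the shift on [0,1]^ℤ). *)

theory Defs
  imports "HOL-Probability.Probability"
begin

text \<open>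
  The compact metric space is the whole type \<open>'a\<close>, i.e. \<open>compact (UNIV :: 'a set)\<close> is assumed
  where needed. Sums, cardinalities, roots and limits are taken in \<open>[0, \<infinity>]\<close>
  (type \<^typ>\<open>ennreal\<close>), so that infinite spanning sets and infinite limits have their usual meaning;
  logarithms of such values lie in \<open>[-\<infinity>, \<infinity>]\<close> (type \<^typ>\<open>ereal\<close>).
\<close>

definition ln_ennreal :: "ennreal \<Rightarrow> ereal" where
  "ln_ennreal x =
     (if x = 0 then -\<infinity> else if x = \<infinity> then \<infinity> else ereal (ln (enn2real x)))"

definition root_ennreal :: "nat \<Rightarrow> ennreal \<Rightarrow> ennreal" where
  "root_ennreal n x = (if x = \<infinity> then \<infinity> else ennreal (root n (enn2real x)))"

definition invariant_measures :: "('a::topological_space \<Rightarrow> 'a) \<Rightarrow> 'a measure set" where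
  "invariant_measures \<alpha> =
     {\<mu>. sets \<mu> = sets borel \<and> prob_space \<mu> \<and> distr \<mu> borel \<alpha> = \<mu>}"

definition essential_set :: "('a::topological_space \<Rightarrow> 'a) \<Rightarrow> 'a set" where
  "essential_set \<alpha> =
     {x. \<forall>V. open V \<and> x \<in> V \<longrightarrow> (\<exists>\<mu>\<in>invariant_measures \<alpha>. measure \<mu> V > 0)}"

text \<open>Both copies of \<open>S\<close> carry the subspace topology.\<close>

definition local_homeomorphism_on ::
    "'a::topological_space set \<Rightarrow> ('a \<Rightarrow> 'a) \<Rightarrow> bool" where
  "local_homeomorphism_on S f \<longleftrightarrow>
     (\<forall>x\<in>S. \<exists>U V g. x \<in> U \<and> openin (top_of_set S) U \<and> openin (top_of_set S) V
        \<and> homeomorphism U V f g)"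

text \<open>
  The maximum is over an empty set for \<open>n = 0\<close>, where its value is irrelevant: only the behaviour as
  \<open>n \<longrightarrow> \<infinity>\<close> enters the quantities below.
\<close>

definition dyn_dist :: "('a::metric_space \<Rightarrow> 'a) \<Rightarrow> nat \<Rightarrow> 'a \<Rightarrow> 'a \<Rightarrow> real" where
  "dyn_dist \<alpha> n x y = (MAX i\<in>{..<n}. dist ((\<alpha> ^^ i) x) ((\<alpha> ^^ i) y))"

definition spanning ::
    "('a::metric_space \<Rightarrow> 'a) \<Rightarrow> 'a set \<Rightarrow> nat \<Rightarrow> real \<Rightarrow> 'a set \<Rightarrow> bool" where
  "spanning \<alpha> S n \<epsilon> E \<longleftrightarrow> E \<subseteq> S \<and> (\<forall>x\<in>S. \<exists>y\<in>E. dyn_dist \<alpha> n x y < \<epsilon>)"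

definition orbit_prod :: "('a \<Rightarrow> 'a) \<Rightarrow> ('a \<Rightarrow> real) \<Rightarrow> nat \<Rightarrow> 'a \<Rightarrow> real" where
  "orbit_prod \<alpha> a n y = (\<Prod>i<n. a ((\<alpha> ^^ i) y))"

text \<open>\<open>pressure \<alpha> a\<close> is the topological pressure of \<open>ln a\<close>, i.e. \<open>P(\<alpha>, ln a)\<close>.\<close>

definition pressure :: "('a::metric_space \<Rightarrow> 'a) \<Rightarrow> ('a \<Rightarrow> real) \<Rightarrow> ereal" where
  "pressure \<alpha> a =
     ln_ennreal (Lim (at_right (0::real)) (\<lambda>\<epsilon>. limsup (\<lambda>n.
       INF E\<in>{E. spanning \<alpha> UNIV n \<epsilon> E}.
         root_ennreal n (\<Sum>\<^sub>\<infinity>y\<in>E. ennreal (orbit_prod \<alpha> a n y)))))"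

text \<open>
  The counting measure gives cardinality with value \<open>\<infinity>\<close> on infinite sets, unlike \<^const>\<open>card\<close>.
\<close>

definition forward_entropy :: "('a::metric_space \<Rightarrow> 'a) \<Rightarrow> ereal" where
  "forward_entropy \<alpha> =
     ln_ennreal (Lim (at_right (0::real)) (\<lambda>\<epsilon>. limsup (\<lambda>n.
       INF E\<in>{E. spanning \<alpha> (essential_set \<alpha>) n \<epsilon> E}.
         root_ennreal n (emeasure (count_space UNIV) ((\<alpha> ^^ n) ` E)))))"

definition essential_spectral_potential ::
    "('a::topological_space \<Rightarrow> 'a) \<Rightarrow> ('a \<Rightarrow> real) \<Rightarrow> ereal" where
  "essential_spectral_potential \<alpha> a =
     ln_ennreal (lim (\<lambda>n. SUP x\<in>essential_set \<alpha>.
       root_ennreal n (\<Sum>\<^sub>\<infinity>y\<in>(\<alpha> ^^ n) -` {x} \<inter> essential_set \<alpha>. ennreal (orbit_prod \<alpha> a n y))))"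

end

theory Submission
  imports Defs
begin

text \<open>
  Write \<open>Y\<close> for the essential set, \<open>P(\<epsilon>)\<close> and \<open>\<gamma>(\<epsilon>)\<close> for the pressure and the forward entropy at scale
  \<open>\<epsilon>\<close>, \<open>v(n)\<close> for the supremum defining the potential and \<open>L = lim v(n)\<close>, which exists by Fekete's lemma.
  Distinct points of one fiber of \<open>\<alpha> ^^ n\<close> in \<open>Y\<close> are \<open>(n, \<rho>)\<close>-separated for a fixed \<open>\<rho> > 0\<close>, so a fiber
  injects into every \<open>(n, \<epsilon>)\<close>-spanning set with \<open>\<epsilon> \<le> \<rho> / 2\<close>, with comparable weights; this is the upper bound on the potential.

  For the lower bound the pressure must be computed on \<open>Y\<close>. A weak limit of empirical measures shows that
  the proportion of time an orbit spends outside a neighborhood of \<open>Y\<close> is uniformly small. Hence almost all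
  of an orbit can be coded by an \<open>(m, \<epsilon>)\<close>-spanning set \<open>E\<close> of \<open>Y\<close>, which bounds \<open>P(2\<epsilon>)\<close> essentially by the
  \<open>m\<close>-th root of the sum over \<open>E\<close>. Splitting \<open>E\<close> into fibers over \<open>(\<alpha> ^^ m) ` E\<close> bounds this sum by
  \<open>card ((\<alpha> ^^ m) ` E) * v(m) ^ m\<close>, whence \<open>P(2\<epsilon>) \<le> L * \<gamma>(\<epsilon>)\<close> up to factors close to 1.
\<close>

subsection \<open>Empirical measures and invariant measures\<close>

text \<open>Divided by \<open>n\<close>, this is the mass that the empirical measure of the first
  \<open>n\<close> points of the orbit of \<open>x\<close> gives to \<open>A\<close>. Time 0 is
  counted, time \<open>n\<close> is not.\<close>

definition visits :: "('a \<Rightarrow> 'a) \<Rightarrow> 'a set \<Rightarrow> nat \<Rightarrow> 'a \<Rightarrow> nat" where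
  "visits f A n x = card {i\<in>{..<n}. (f ^^ i) x \<in> A}"

lemma visits_le: "visits f A n x \<le> n"
  unfolding visits_def using card_mono[of "{..<n}" "{i\<in>{..<n}. (f ^^ i) x \<in> A}"] by auto

lemma visits_UNIV: "visits f UNIV n x = n"
  by (simp add: visits_def)

lemma visits_Un_disjoint:
  assumes "A \<inter> B = {}"
  shows "visits f (A \<union> B) n x = visits f A n x + visits f B n x"
proof -
  have "{i\<in>{..<n}. (f ^^ i) x \<in> A \<union> B} = {i\<in>{..<n}. (f ^^ i) x \<in> A} \<union> {i\<in>{..<n}. (f ^^ i) x \<in> B}"
    by auto
  then show ?thesis
    unfolding visits_def using assms by (subst card_Un_disjoint[symmetric]) auto
qed

lemma visits_Suc: "visits f A (Suc n) x = (if x \<in> A then 1 else 0) + visits f A n (f x)"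
proof -
  have "{i\<in>{..<Suc n}. (f ^^ i) x \<in> A} =
      (if x \<in> A then {0} else {}) \<union> Suc ` {i\<in>{..<n}. (f ^^ i) (f x) \<in> A}"
    by (auto simp: lessThan_Suc_eq_insert_0 funpow_swap1 image_iff)
  then show ?thesis
    unfolding visits_def by (auto simp: card_image card_insert_if)
qed

lemma visits_Suc': "visits f A (Suc n) x = visits f A n x + (if (f ^^ n) x \<in> A then 1 else 0)"
proof -
  have "{i\<in>{..<Suc n}. (f ^^ i) x \<in> A} =
      (if (f ^^ n) x \<in> A then {n} else {}) \<union> {i\<in>{..<n}. (f ^^ i) x \<in> A}"
    by (auto simp: less_Suc_eq)
  then show ?thesis
    unfolding visits_def by (auto simp: card_insert_if)
qed

lemma visits_vimage: "visits f (f -` A) n x = visits f A n (f x)"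
  by (simp add: visits_def funpow_swap1)

text \<open>Passing to the preimage shifts the time window by one step, so only times 0 and
  \<open>n\<close> can make a difference. Empirical measures are thus invariant up to
  \<open>1 / n\<close>.\<close>

lemma visits_vimage_dist: "\<bar>real (visits f (f -` A) n x) - real (visits f A n x)\<bar> \<le> 1"
  using visits_Suc[of f A n x] visits_Suc'[of f A n x] by (auto simp: visits_vimage split: if_splits)

lemma visits_add: "visits f A (m + n) x = visits f A m x + visits f A n ((f ^^ m) x)"
  proof (induction m arbitrary: x)
  case 0
  then show ?case by (simp add: visits_def)
next
  case (Suc m)
  then show ?case by (simp add: visits_Suc funpow_swap1)
qed

text \<open>Tychonoff's theorem. It supplies cluster points of functions defined on all subsets of a
  space, where convergent subsequences may fail to exist.\<close>

lemma compact_unit_valued: "compact {m :: 'b \<Rightarrow> real. \<forall>A. m A \<in> {0..1}}"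
proof -
  have "compactin (product_topology (\<lambda>_. euclidean) UNIV) (\<Pi>\<^sub>E A\<in>UNIV::'b set. {0..1::real})"
    by (subst compactin_PiE) auto
  moreover have "(\<Pi>\<^sub>E A\<in>UNIV::'b set. {0..1::real}) = {m. \<forall>A. m A \<in> {0..1}}"
    by auto
  ultimately show ?thesis
    by (simp add: euclidean_product_topology)
qed

text \<open>A Krylov-Bogolyubov argument for finitely additive set functions: \<open>m\<close> is a
  cluster point of empirical measures in the product topology. Evaluation at a set is continuous
  there, so relations between finitely many values survive the limit.\<close>

lemma ex_invariant_content:
  fixes f :: "'a \<Rightarrow> 'a"
  assumes freq: "\<exists>\<^sub>F n in sequentially. \<exists>x. \<delta> * real n \<le> real (visits f F n x)"
  obtains m :: "'a set \<Rightarrow> real" where "\<And>A. 0 \<le> m A" "m UNIV = 1"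
    "\<And>A B. A \<inter> B = {} \<Longrightarrow> m (A \<union> B) = m A + m B" "\<And>A. m (f -` A) = m A" "\<delta> \<le> m F"
proof -
  define N where "N = {n. \<exists>x. \<delta> * real n \<le> real (visits f F n x)}"
  define x where "x n = (SOME x. \<delta> * real n \<le> real (visits f F n x))" for n
  have x: "\<delta> * real n \<le> real (visits f F n (x n))" if "n \<in> N" for n
    using someI_ex[of "\<lambda>x. \<delta> * real n \<le> real (visits f F n x)"] that unfolding N_def x_def by auto
  define e where "e n A = real (visits f A n (x n)) / real n" for n A
  \<comment> \<open>Large times from \<open>N\<close> only, where \<open>x n\<close> is a genuine
    witness. The filter is proper since \<open>N\<close> is infinite by \<open>freq\<close>.\<close>
  define G where "G = inf sequentially (principal N)"
  have "G \<noteq> bot"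
    using freq unfolding G_def N_def frequently_def trivial_limit_def
    by (auto simp: eventually_inf_principal)
  moreover have pos: "\<forall>\<^sub>F n in G. n > 0 \<and> n \<in> N"
    unfolding G_def eventually_inf_principal
    by (rule eventually_mono[OF eventually_gt_at_top[of 0]]) auto
  ultimately have ne: "filtermap e G \<noteq> bot"
    by (simp add: filtermap_bot_iff)
  have e01: "e n A \<in> {0..1}" for n A
    using visits_le[of f A n "x n"] by (auto simp: e_def divide_le_eq_1)
  then have "\<forall>\<^sub>F m in filtermap e G. m \<in> {m. \<forall>A. m A \<in> {0..1}}"
    by (auto simp: eventually_filtermap)
  then obtain m where m: "\<forall>A. m A \<in> {0..1}" and lim: "inf (nhds m) (filtermap e G) \<noteq> bot"
    using compact_unit_valued ne unfolding compact_filter by blast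
  have closed_mem: "m \<in> C" if "closed C" "\<forall>\<^sub>F n in G. e n \<in> C" for C
  proof (rule ccontr)
    assume "m \<notin> C"
    then have "\<forall>\<^sub>F m in nhds m. m \<in> - C"
      using that(1) by (intro eventually_nhds_in_open) auto
    moreover have "\<forall>\<^sub>F m in filtermap e G. m \<in> C"
      using that(2) by (simp add: eventually_filtermap)
    ultimately have "\<forall>\<^sub>F m in inf (nhds m) (filtermap e G). False"
      unfolding eventually_inf by (intro exI[of _ "\<lambda>m. m \<in> - C"] exI[of _ "\<lambda>m. m \<in> C"]) auto
    then show False
      using lim by (simp add: trivial_limit_def)
  qed
  have cont: "continuous_on UNIV (\<lambda>m :: 'a set \<Rightarrow> real. m A)" for A
    by simp
  show thesis
  proof (rule that[of m])
    show "0 \<le> m A" for A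
      using m by auto
    have "m \<in> {m. m UNIV = 1}"
      by (intro closed_mem closed_Collect_eq cont continuous_on_const)
        (use pos in \<open>auto elim!: eventually_mono simp: e_def visits_UNIV\<close>)
    then show "m UNIV = 1" by simp
    show "m (A \<union> B) = m A + m B" if "A \<inter> B = {}" for A B
    proof -
      have "m \<in> {m. m (A \<union> B) = m A + m B}"
        by (intro closed_mem closed_Collect_eq cont continuous_on_add)
          (auto simp: e_def visits_Un_disjoint[OF that] add_divide_distrib)
      then show ?thesis by simp
    qed
    have "m \<in> {m. \<delta> \<le> m F}"
      by (intro closed_mem closed_Collect_le cont continuous_on_const)
        (use pos x in \<open>auto elim!: eventually_mono simp: e_def field_simps\<close>)
    then show "\<delta> \<le> m F" by simp
    show "m (f -` A) = m A" for A
    proof -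
      \<comment> \<open>For \<open>e n\<close> invariance holds only up to \<open>1 / n\<close>, so
        closedness is applied to the inequality with a fixed \<eta> > 0.\<close>
      have "\<bar>m (f -` A) - m A\<bar> \<le> \<eta>" if "\<eta> > 0" for \<eta>
      proof -
        have "\<bar>e n (f -` A) - e n A\<bar> \<le> 1 / real n" for n
          using visits_vimage_dist[of f A n "x n"]
          by (simp add: e_def flip: diff_divide_distrib) (simp add: divide_right_mono)
        moreover have "\<forall>\<^sub>F n in sequentially. 1 / real n < \<eta>"
          using lim_1_over_n[where 'a=real] that by (auto simp: order_tendsto_iff)
        then have "\<forall>\<^sub>F n in G. 1 / real n < \<eta>"
          unfolding G_def by (simp add: eventually_inf_principal eventually_mono)
        ultimately have "m \<in> {m. \<bar>m (f -` A) - m A\<bar> \<le> \<eta>}"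
          by (intro closed_mem closed_Collect_le continuous_on_rabs continuous_on_diff cont continuous_on_const)
            (auto elim!: eventually_mono intro: order_trans less_imp_le)
        then show ?thesis by simp
      qed
      then have "\<bar>m (f -` A) - m A\<bar> \<le> 0"
        by (rule field_le_epsilon) simp
      then show ?thesis by simp
    qed
  qed
qed

section \<open>From finitely additive contents to Borel measures\<close>

lemma closed_ball_subset:
  fixes V :: "'a::metric_space set"
  shows "closed {x. ball x r \<subseteq> V}"
proof -
  have "- {x. ball x r \<subseteq> V} = (\<Union>y\<in>-V. ball y r)"
    by (auto simp: dist_commute)
  then show ?thesis
    by (metis closed_def open_UN open_ball)
qed

text \<open>The outer measure induced by the inner regularization of \<open>m\<close> on open sets makes every open set
  measurable in the sense of Caratheodory, since a compact set splits off from an open one.\<close>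

lemma ex_borel_measure_of_content:
  fixes m :: "'a::metric_space set \<Rightarrow> real"
  assumes cpt: "compact (UNIV :: 'a set)"
    and nonneg: "\<And>A. 0 \<le> m A"
    and add: "\<And>A B. A \<inter> B = {} \<Longrightarrow> m (A \<union> B) = m A + m B"
  obtains \<mu> :: "'a measure" where "sets \<mu> = sets borel"
    "\<And>V. open V \<Longrightarrow> emeasure \<mu> V = (SUP K\<in>{K. compact K \<and> K \<subseteq> V}. ennreal (m K))"
proof -
  have mono: "m A \<le> m B" if "A \<subseteq> B" for A B
  proof -
    have "m (A \<union> (B - A)) = m A + m (B - A)"
      by (intro add) auto
    then show ?thesis
      using nonneg[of "B - A"] that by (simp add: Un_absorb1)
  qed
  have m0: "m {} = 0"
    using add[of "{}" "{}"] by simp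
  have sub2: "m (A \<union> B) \<le> m A + m B" for A B
    using add[of A "B - A"] mono[of "B - A" B] by simp
  have sub: "m (\<Union>i\<in>I. A i) \<le> (\<Sum>i\<in>I. m (A i))" if "finite I" for I :: "nat set" and A
    using that
  proof (induction I rule: finite_induct)
    case (insert i I)
    then show ?case using sub2[of "A i" "\<Union>i\<in>I. A i"] by simp
  qed (simp add: m0)
  define inn where "inn V = (SUP K\<in>{K. compact K \<and> K \<subseteq> V}. ennreal (m K))" for V
  define out where "out A = (INF V\<in>{V. open V \<and> A \<subseteq> V}. inn V)" for A
  have inn_mono: "inn V \<le> inn W" if "V \<subseteq> W" for V W
    unfolding inn_def using that by (intro SUP_subset_mono) auto
  have le_inn: "ennreal (m K) \<le> inn V" if "compact K" "K \<subseteq> V" for K V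
    unfolding inn_def using that by (intro SUP_upper) auto
  have inn_le: "inn V \<le> ennreal (m UNIV)" for V
    unfolding inn_def by (intro SUP_least ennreal_leI mono) auto
  have inn_fin: "inn V \<noteq> \<infinity>" for V
    using inn_le[of V] by (metis ennreal_neq_top infinity_ennreal_def top.extremum_uniqueI)
  have out_open: "out V = inn V" if "open V" for V
    unfolding out_def using that by (intro antisym INF_lower INF_greatest inn_mono) auto
  have out_le: "out A \<le> inn V" if "open V" "A \<subseteq> V" for A V
    unfolding out_def using that by (intro INF_lower) auto
  have out_mono: "out A \<le> out B" if "A \<subseteq> B" for A B
    unfolding out_def using that by (intro INF_superset_mono) auto
  have out_approx: "\<exists>V. open V \<and> A \<subseteq> V \<and> inn V \<le> out A + ennreal e" if "e > 0" for A e
  proof -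
    have "out A \<noteq> \<infinity>"
      using out_le[of UNIV A] inn_fin[of UNIV] by (auto simp: top_unique)
    from INF_approx_ennreal[OF that out_def this] show ?thesis
      by (auto intro: less_imp_le)
  qed
  have inn_UN: "inn (\<Union>i. V i) \<le> (\<Sum>i. inn (V i))" if op: "\<And>i. open (V i)" for V :: "nat \<Rightarrow> 'a set"
    unfolding inn_def[of "\<Union>i. V i"]
  proof (intro SUP_least; clarify)
    fix K :: "'a set"
    assume K: "compact K" "K \<subseteq> (\<Union>i. V i)"
    obtain I where I: "finite I" "K \<subseteq> (\<Union>i\<in>I. V i)"
      using compactE_image[OF K(1), of UNIV V] op K(2) by metis
    obtain r where r: "r > 0" "\<And>x. x \<in> K \<Longrightarrow> \<exists>G\<in>V ` I. ball x r \<subseteq> G"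
      using Heine_Borel_lemma[OF K(1), of "V ` I"] I(2) op by blast
    \<comment> \<open>\<open>r\<close> is a Lebesgue number of the cover, so the compact pieces
      \<open>L i\<close> cover \<open>K\<close>, and finite subadditivity of \<open>m\<close>
      suffices.\<close>
    define L where "L i = K \<inter> {x. ball x r \<subseteq> V i}" for i
    have L: "compact (L i)" "L i \<subseteq> V i" for i
      using K(1) r(1) closed_ball_subset[of r "V i"]
      by (auto simp: L_def intro!: compact_Int_closed)
    have "m K \<le> m (\<Union>i\<in>I. L i)"
      using r(2) by (intro mono) (force simp: L_def)
    also have "\<dots> \<le> (\<Sum>i\<in>I. m (L i))"
      by (rule sub[OF I(1)])
    finally have "ennreal (m K) \<le> (\<Sum>i\<in>I. ennreal (m (L i)))"
      by (simp add: ennreal_leI nonneg)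
    also have "\<dots> \<le> (\<Sum>i\<in>I. inn (V i))"
      by (intro sum_mono le_inn L)
    also have "\<dots> \<le> (\<Sum>i. inn (V i))"
      using I(1) by (intro sum_le_suminf) auto
    finally show "ennreal (m K) \<le> (\<Sum>i. inn (V i))" .
  qed
  have "countably_subadditive UNIV out"
    unfolding countably_subadditive_def
  proof (intro allI impI)
    fix A :: "nat \<Rightarrow> 'a set"
    show "out (\<Union>i. A i) \<le> (\<Sum>i. out (A i))"
    proof (rule ennreal_le_epsilon)
      fix e :: real
      assume e: "0 < e"
      have "\<exists>V. open V \<and> A i \<subseteq> V \<and> inn V \<le> out (A i) + ennreal (e * (1/2) ^ Suc i)" for i
        using e by (intro out_approx) auto
      then obtain V where V: "\<And>i. open (V i)" "\<And>i. A i \<subseteq> V i"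
          "\<And>i. inn (V i) \<le> out (A i) + ennreal (e * (1/2) ^ Suc i)"
        by metis
      have "out (\<Union>i. A i) \<le> inn (\<Union>i. V i)"
        using V(1,2) by (intro out_le) auto
      also have "\<dots> \<le> (\<Sum>i. inn (V i))"
        by (rule inn_UN[OF V(1)])
      also have "\<dots> \<le> (\<Sum>i. out (A i) + ennreal (e * (1/2) ^ Suc i))"
        by (intro suminf_le V(3)) auto
      also have "\<dots> = (\<Sum>i. out (A i)) + (\<Sum>i. ennreal e * ennreal ((1/2) ^ Suc i))"
        using e by (subst suminf_add[symmetric])
          (auto simp del: ennreal_suminf_cmult simp add: ennreal_mult[symmetric])
      also have "\<dots> = (\<Sum>i. out (A i)) + ennreal e"
        unfolding ennreal_suminf_cmult
        by (subst suminf_ennreal_eq[OF zero_le_power power_half_series]) auto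
      finally show "out (\<Union>i. A i) \<le> (\<Sum>i. out (A i)) + ennreal e" .
    qed
  qed
  moreover have out0: "out {} = 0"
    using le_inn[of "{}" "{}"] by (simp add: out_open) (simp add: inn_def m0 cong: conj_cong)
  ultimately have oms: "outer_measure_space UNIV out"
    by (auto simp: outer_measure_space_def positive_def increasing_def out_mono)
  then have ms: "measure_space UNIV (lambda_system UNIV UNIV out) out"
    using sigma_algebra.caratheodory_lemma[of UNIV UNIV] sigma_algebra_Pow[of UNIV] by simp
  have split_ge: "out (W \<inter> A) + out ((UNIV - W) \<inter> A) \<le> out A" if W: "open W" for W A
  proof (rule ennreal_le_epsilon)
    fix e :: real
    assume "0 < e"
    then have e: "e / 3 > 0" by simp
    obtain V where V: "open V" "A \<subseteq> V" "inn V \<le> out A + ennreal (e/3)"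
      using out_approx[OF e] by metis
    have approx: "\<exists>K. compact K \<and> K \<subseteq> V \<and> inn V \<le> ennreal (m K) + ennreal (e/3)" for V
    proof -
      have "{K. compact K \<and> K \<subseteq> V} \<noteq> {}"
        by (auto intro: exI[of _ "{}"])
      from SUP_approx_ennreal[OF e this inn_def inn_fin] show ?thesis
        by (auto intro: less_imp_le)
    qed
    \<comment> \<open>\<open>K\<close> nearly exhausts \<open>W \<inter> V\<close>. The set
      \<open>V - K\<close> is open and contains the part of \<open>A\<close> outside
      \<open>W\<close>, while compact sets in it are disjoint from \<open>K\<close>, so that
      \<open>m\<close> adds up inside \<open>V\<close>.\<close>
    obtain K where K: "compact K" "K \<subseteq> W \<inter> V" "inn (W \<inter> V) \<le> ennreal (m K) + ennreal (e/3)"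
      using approx by metis
    obtain L where L: "compact L" "L \<subseteq> V - K" "inn (V - K) \<le> ennreal (m L) + ennreal (e/3)"
      using approx by metis
    have "out (W \<inter> A) + out ((UNIV - W) \<inter> A) \<le> inn (W \<inter> V) + inn (V - K)"
      using V K W compact_imp_closed by (intro add_mono out_le) auto
    also have "\<dots> \<le> ennreal (m K) + ennreal (e/3) + (ennreal (m L) + ennreal (e/3))"
      by (intro add_mono K L)
    also have "\<dots> = ennreal (m (K \<union> L)) + ennreal (2 * e/3)"
      using L(2) \<open>0 < e\<close> by (subst add) (auto simp: nonneg simp flip: ennreal_plus)
    also have "\<dots> \<le> inn V + ennreal (2 * e/3)"
      using K L by (intro add_mono le_inn) auto
    also have "\<dots> \<le> out A + ennreal (e/3) + ennreal (2 * e/3)"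
      by (intro add_mono V) auto
    also have "\<dots> = out A + ennreal e"
      using \<open>0 < e\<close> by (simp add: add.assoc flip: ennreal_plus)
    finally show "out (W \<inter> A) + out ((UNIV - W) \<inter> A) \<le> out A + ennreal e" .
  qed
  have split: "out (W \<inter> A) + out ((UNIV - W) \<inter> A) = out A" if W: "open W" for W A
  proof (rule antisym[OF split_ge[OF W]])
    have "subadditive UNIV out"
      using \<open>countably_subadditive UNIV out\<close> out0 ring_of_sets.countably_subadditive_subadditive[of UNIV UNIV out]
      by (simp add: positive_def ring_of_sets_Pow[of UNIV, simplified])
    moreover have "W \<inter> A \<union> (UNIV - W) \<inter> A = A"
      by auto
    ultimately show "out A \<le> out (W \<inter> A) + out ((UNIV - W) \<inter> A)"
      using subadditiveD[of UNIV out "W \<inter> A" "(UNIV - W) \<inter> A"] by auto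
  qed
  have "Collect open \<subseteq> lambda_system UNIV UNIV out"
    using split by (auto simp: lambda_system_def)
  then have "sets borel \<subseteq> lambda_system UNIV UNIV out"
    using ms sigma_algebra.sigma_sets_subset[of UNIV "lambda_system UNIV UNIV out" "Collect open"]
    by (simp add: borel_def measure_space_def)
  then have "measure_space UNIV (sets (borel :: 'a measure)) out"
    using measure_down[OF ms, of "sets borel"] sets.sigma_algebra_axioms[of "borel :: 'a measure"] by simp
  then have pos: "positive (sets (borel :: 'a measure)) out" "countably_additive (sets (borel :: 'a measure)) out"
    by (auto simp: measure_space_def)
  define \<mu> where "\<mu> = measure_of UNIV (sets (borel :: 'a measure)) out"
  show thesis
  proof (rule that[of \<mu>])
    show sets: "sets \<mu> = sets borel"
      unfolding \<mu>_def using sets.sets_measure_of_eq[of "borel :: 'a measure"] by simp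
    show "emeasure \<mu> V = (SUP K\<in>{K. compact K \<and> K \<subseteq> V}. ennreal (m K))" if "open V" for V
      using that sets pos by (subst emeasure_measure_of[OF \<mu>_def]) (auto simp: out_open inn_def)
  qed
qed

text \<open>Complements turn the hypothesis into the opposite inequality on closed sets. Open sets
  are increasing unions of closed sets, which gives equality on them, and they form an
  intersection-stable generator.\<close>

lemma distr_eqI_open:
  fixes \<mu> :: "'a::metric_space measure"
  assumes \<mu>: "prob_space \<mu>" "sets \<mu> = sets borel" and f: "continuous_on UNIV f"
    and le: "\<And>V. open V \<Longrightarrow> emeasure \<mu> V \<le> emeasure \<mu> (f -` V)"
  shows "distr \<mu> borel f = \<mu>"
proof -
  interpret prob_space \<mu> by fact
  have space: "space \<mu> = UNIV"
    using \<mu>(2) sets_eq_imp_space_eq by fastforce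
  have meas: "f \<in> \<mu> \<rightarrow>\<^sub>M borel"
    using borel_measurable_continuous_onI[OF f] measurable_cong_sets[OF \<mu>(2) refl] by blast
  define \<nu> where "\<nu> = distr \<mu> borel f"
  interpret \<nu>: prob_space \<nu>
    unfolding \<nu>_def by (rule prob_space_distr[OF meas])
  have space\<nu>: "space \<nu> = UNIV" and sets\<nu>: "sets \<nu> = sets borel"
    by (auto simp: \<nu>_def)
  have le': "prob V \<le> \<nu>.prob V" if "open V" for V
    using le[OF that] that meas \<mu>(2)
    by (simp add: \<nu>_def measure_distr space emeasure_eq_measure)
  have closed_le: "\<nu>.prob C \<le> prob C" if "closed C" for C
    using le'[of "-C"] prob_compl[of C] \<nu>.prob_compl[of C] that \<mu>(2)
    by (simp add: space space\<nu> sets\<nu> Compl_eq_Diff_UNIV open_Diff)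
  have open_eq: "emeasure \<nu> V = emeasure \<mu> V" if V: "open V" for V
  proof (rule antisym)
    define C where "C n = {x. ball x (1 / real (Suc n)) \<subseteq> V}" for n
    have C: "closed (C n)" for n
      unfolding C_def by (rule closed_ball_subset)
    have CV: "C n \<subseteq> V" for n
      by (auto simp: C_def subset_iff)
    have "ball x (1 / real (Suc n)) \<subseteq> ball x (1 / real (Suc m))" if "m \<le> n" for x :: 'a and m n
      using that by (intro subset_ball) (simp add: frac_le)
    then have "incseq C"
      unfolding C_def incseq_def by blast
    moreover have "(\<Union>n. C n) = V"
    proof (intro antisym subsetI)
      fix x assume "x \<in> V"
      then obtain e where "e > 0" "ball x e \<subseteq> V"
        using V openE by blast
      moreover obtain n where "inverse (real (Suc n)) < e"
        using reals_Archimedean[OF \<open>e > 0\<close>] by auto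
      ultimately have "ball x (1 / real (Suc n)) \<subseteq> V"
        using subset_ball[of "1 / real (Suc n)" e x] by (simp add: divide_inverse)
      then show "x \<in> (\<Union>n. C n)"
        by (auto simp: C_def)
    qed (use CV in auto)
    ultimately have "emeasure \<nu> V = (SUP n. emeasure \<nu> (C n))"
      using C by (subst SUP_emeasure_incseq) (auto simp: sets\<nu>)
    also have "\<dots> \<le> emeasure \<mu> V"
    proof (rule SUP_least)
      fix n
      have "prob (C n) \<le> prob V"
        using CV V \<mu>(2) by (intro finite_measure_mono) auto
      then show "emeasure \<nu> (C n) \<le> emeasure \<mu> V"
        using closed_le[OF C, of n] by (simp add: emeasure_eq_measure \<nu>.emeasure_eq_measure)
    qed
    finally show "emeasure \<nu> V \<le> emeasure \<mu> V" .
    show "emeasure \<mu> V \<le> emeasure \<nu> V"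
      using le'[OF V] by (simp add: emeasure_eq_measure \<nu>.emeasure_eq_measure)
  qed
  show ?thesis
    unfolding \<nu>_def[symmetric]
  proof (rule measure_eqI_generator_eq[of "Collect open" UNIV _ _ "\<lambda>_. UNIV"])
    show "Int_stable (Collect open :: 'a set set)"
      by (auto simp: Int_stable_def)
    show "sets \<nu> = sigma_sets UNIV (Collect open)" "sets \<mu> = sigma_sets UNIV (Collect open)"
      by (simp_all add: sets\<nu> \<mu>(2) borel_def)
  qed (auto simp: open_eq)
qed

text \<open>The measure built from the invariant content inherits invariance because the preimage of
  a compact subset of an open \<open>V\<close> is a compact subset of the preimage of
  \<open>V\<close>.\<close>

lemma ex_invariant_measure:
  fixes f :: "'a::metric_space \<Rightarrow> 'a"
  assumes cpt: "compact (UNIV :: 'a set)" and f: "continuous_on UNIV f" and F: "closed F"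
    and freq: "\<exists>\<^sub>F n in sequentially. \<exists>x. \<delta> * real n \<le> real (visits f F n x)"
  obtains \<mu> where "\<mu> \<in> invariant_measures f" "\<delta> \<le> measure \<mu> F"
proof -
  obtain m :: "'a set \<Rightarrow> real" where nonneg: "\<And>A. 0 \<le> m A" and m1: "m UNIV = 1"
    and add: "\<And>A B. A \<inter> B = {} \<Longrightarrow> m (A \<union> B) = m A + m B"
    and inv: "\<And>A. m (f -` A) = m A" and mF: "\<delta> \<le> m F"
    using ex_invariant_content[OF freq] by metis
  obtain \<mu> :: "'a measure" where \<mu>: "sets \<mu> = sets borel"
    "\<And>V. open V \<Longrightarrow> emeasure \<mu> V = (SUP K\<in>{K. compact K \<and> K \<subseteq> V}. ennreal (m K))"
    using ex_borel_measure_of_content[OF cpt nonneg add] by metis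
  have mono: "m A \<le> m B" if "A \<subseteq> B" for A B
  proof -
    have "m (A \<union> (B - A)) = m A + m (B - A)"
      by (intro add) auto
    then show ?thesis
      using nonneg[of "B - A"] that by (simp add: Un_absorb1)
  qed
  have space: "space \<mu> = UNIV"
    using sets_eq_imp_space_eq[OF \<mu>(1)] by simp
  have "emeasure \<mu> UNIV = 1"
  proof (rule antisym)
    show "emeasure \<mu> UNIV \<le> 1"
      unfolding \<mu>(2)[OF open_UNIV]
    proof (rule SUP_least)
      show "ennreal (m K) \<le> 1" for K
        using mono[of K UNIV] m1 ennreal_leI[of "m K" 1] by simp
    qed
    show "1 \<le> emeasure \<mu> UNIV"
      unfolding \<mu>(2)[OF open_UNIV] using cpt by (intro SUP_upper2[of UNIV]) (simp_all add: m1)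
  qed
  then have prob: "prob_space \<mu>"
    by (intro prob_spaceI) (simp add: space)
  then interpret prob_space \<mu> .
  have "distr \<mu> borel f = \<mu>"
  proof (rule distr_eqI_open[OF prob \<mu>(1) f])
    fix V :: "'a set"
    assume V: "open V"
    show "emeasure \<mu> V \<le> emeasure \<mu> (f -` V)"
      unfolding \<mu>(2)[OF V] \<mu>(2)[OF open_vimage[OF V f]]
    proof (intro SUP_least; clarify)
      fix K :: "'a set"
      assume K: "compact K" "K \<subseteq> V"
      have "compact (f -` K)"
        using cpt closed_vimage[OF compact_imp_closed[OF K(1)] f]
        by (metis compact_Int_closed inf_top_left)
      then show "ennreal (m K) \<le> (SUP K\<in>{K. compact K \<and> K \<subseteq> f -` V}. ennreal (m K))"
        using K(2) by (intro SUP_upper2[of "f -` K"]) (auto simp: inv)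
    qed
  qed
  then have "\<mu> \<in> invariant_measures f"
    using \<mu>(1) prob by (simp add: invariant_measures_def)
  moreover have "\<delta> \<le> measure \<mu> F"
  proof -
    \<comment> \<open>By inner approximation the measure is at most \<open>m\<close> on open sets.
      Complements make it at least \<open>m\<close> on the closed set \<open>F\<close>: mass may be
      gained there but not lost.\<close>
    have "emeasure \<mu> (-F) \<le> ennreal (m (-F))"
      using F by (subst \<mu>(2)) (auto intro!: SUP_least ennreal_leI mono)
    then have "measure \<mu> (-F) \<le> m (-F)"
      by (simp add: emeasure_eq_measure nonneg)
    moreover have "m F + m (-F) = 1"
      using add[of F "-F"] m1 by simp
    moreover have "measure \<mu> (-F) = 1 - measure \<mu> F"
      using prob_compl[of F] F \<mu>(1) by (simp add: space Compl_eq_Diff_UNIV)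
    ultimately show ?thesis
      using mF by linarith
  qed
  ultimately show thesis ..
qed

section \<open>The essential set and the time spent away from it\<close>

lemma closed_essential_set: "closed (essential_set f)"
proof -
  have "- essential_set f = \<Union>{V. open V \<and> (\<forall>\<mu>\<in>invariant_measures f. \<not> measure \<mu> V > 0)}"
    by (auto simp: essential_set_def)
  then show ?thesis
    unfolding closed_def by auto
qed

text \<open>For an invariant measure, a neighborhood of \<open>f x\<close> has the same mass as its
  preimage, which is a neighborhood of \<open>x\<close>.\<close>

lemma essential_set_invariant:
  assumes f: "continuous_on UNIV f" and x: "x \<in> essential_set f"
  shows "f x \<in> essential_set f"
  unfolding essential_set_def
proof (clarify)
  fix V :: "'a set"
  assume V: "open V" "f x \<in> V"
  then obtain \<mu> where \<mu>: "\<mu> \<in> invariant_measures f" "measure \<mu> (f -` V) > 0"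
    using x open_vimage[OF V(1) f] unfolding essential_set_def by auto
  then have sets: "sets \<mu> = sets borel" and d: "distr \<mu> borel f = \<mu>"
    by (auto simp: invariant_measures_def)
  have "f \<in> \<mu> \<rightarrow>\<^sub>M borel"
    using borel_measurable_continuous_onI[OF f] measurable_cong_sets[OF sets refl] by blast
  moreover have "space \<mu> = UNIV"
    using sets sets_eq_imp_space_eq by fastforce
  ultimately have "measure (distr \<mu> borel f) V = measure \<mu> (f -` V)"
    using V(1) by (subst measure_distr) auto
  then show "\<exists>\<mu>\<in>invariant_measures f. 0 < measure \<mu> V"
    using \<mu> d by (intro bexI[of _ \<mu>]) simp_all
qed

text \<open>Each point of \<open>K\<close> has an open neighborhood that is null for \<mu>, and
  compactness leaves finitely many of them.\<close>

lemma measure_zero_outside_essential_set: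
  assumes \<mu>: "\<mu> \<in> invariant_measures f" and K: "compact K" "K \<inter> essential_set f = {}"
  shows "measure \<mu> K = 0"
proof -
  interpret prob_space \<mu>
    using \<mu> by (simp add: invariant_measures_def)
  have sets: "sets \<mu> = sets borel"
    using \<mu> by (simp add: invariant_measures_def)
  define \<V> where "\<V> = {V. open V \<and> measure \<mu> V = 0}"
  have "K \<subseteq> \<Union>\<V>"
  proof
    fix x assume "x \<in> K"
    then obtain V where "open V" "x \<in> V" "\<not> measure \<mu> V > 0"
      using K(2) \<mu> unfolding essential_set_def by blast
    then show "x \<in> \<Union>\<V>"
      using measure_nonneg[of \<mu> V] unfolding \<V>_def by force
  qed
  then obtain \<W> where \<W>: "\<W> \<subseteq> \<V>" "finite \<W>" "K \<subseteq> \<Union>\<W>"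
    by (rule compactE[OF K(1)]) (auto simp: \<V>_def)
  have "measure \<mu> K \<le> measure \<mu> (\<Union>V\<in>\<W>. V)"
    using \<W> by (intro finite_measure_mono) (auto simp: sets \<V>_def intro!: borel_open)
  also have "\<dots> \<le> (\<Sum>V\<in>\<W>. measure \<mu> V)"
    using \<W> by (intro measure_UNION_le) (auto simp: sets \<V>_def)
  also have "\<dots> = 0"
    using \<W>(1) by (intro sum.neutral) (auto simp: \<V>_def)
  finally show ?thesis
    using measure_nonneg[of \<mu> K] by simp
qed

text \<open>Otherwise \<open>ex_invariant_measure\<close> would put mass at least \<delta> on the
  compact set \<open>-U\<close>, which is null. The bound is uniform in \<open>x\<close> because the
  starting points of the empirical measures may depend on \<open>n\<close>.\<close>

lemma eventually_few_visits_outside: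
  fixes f :: "'a::metric_space \<Rightarrow> 'a"
  assumes cpt: "compact (UNIV :: 'a set)" and f: "continuous_on UNIV f"
    and U: "open U" "essential_set f \<subseteq> U" and \<delta>: "\<delta> > 0"
  shows "\<forall>\<^sub>F n in sequentially. \<forall>x. real (visits f (-U) n x) < \<delta> * real n"
proof (rule ccontr)
  assume "\<not> ?thesis"
  then have "\<exists>\<^sub>F n in sequentially. \<exists>x. \<delta> * real n \<le> real (visits f (-U) n x)"
    by (simp add: not_eventually not_less)
  then obtain \<mu> where \<mu>: "\<mu> \<in> invariant_measures f" "\<delta> \<le> measure \<mu> (-U)"
    using ex_invariant_measure[OF cpt f closed_Compl[OF U(1)]] by blast
  have "compact (-U)"
    using cpt U(1) by (metis closed_Compl compact_Int_closed inf_top_left)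
  then have "measure \<mu> (-U) = 0"
    using U(2) by (intro measure_zero_outside_essential_set[OF \<mu>(1)]) auto
  then show False
    using \<mu>(2) \<delta> by simp
qed

lemma essential_set_nonempty:
  fixes f :: "'a::metric_space \<Rightarrow> 'a"
  assumes cpt: "compact (UNIV :: 'a set)" and f: "continuous_on UNIV f"
  shows "essential_set f \<noteq> {}"
proof
  assume "essential_set f = {}"
  \<comment> \<open>With \<open>U\<close> empty every time counts as a visit outside
    \<open>U\<close>, so \<open>n < n\<close> would follow.\<close>
  then have "\<forall>\<^sub>F n in sequentially. \<forall>x. real (visits f UNIV n x) < 1 * real n"
    using eventually_few_visits_outside[OF cpt f, of "{}" 1] by simp
  then show False
    by (simp add: visits_UNIV)
qed

subsection \<open>Coding of orbits\<close>

lemma orbit_prod_pos: "(\<And>x. a x > 0) \<Longrightarrow> orbit_prod f a n x > 0"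
  by (simp add: orbit_prod_def prod_pos)

lemma orbit_prod_add: "orbit_prod f a (m + n) x = orbit_prod f a m x * orbit_prod f a n ((f ^^ m) x)"
proof (induction n)
  case (Suc n)
  have "(f ^^ (m + n)) x = (f ^^ n) ((f ^^ m) x)"
    by (metis add.commute comp_apply funpow_add)
  then show ?case using Suc by (simp add: orbit_prod_def)
qed (simp add: orbit_prod_def)

lemma orbit_prod_le_power:
  assumes "\<And>x. a x > 0" "\<And>i. i < n \<Longrightarrow> a ((f ^^ i) x) \<le> c * a ((f ^^ i) y)"
  shows "orbit_prod f a n x \<le> c ^ n * orbit_prod f a n y"
proof -
  have "orbit_prod f a n x \<le> (\<Prod>i<n. c * a ((f ^^ i) y))"
    unfolding orbit_prod_def using assms by (intro prod_mono) (auto intro: less_imp_le)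
  then show ?thesis by (simp add: orbit_prod_def prod.distrib)
qed

text \<open>Any single point of such a set can represent all of it in an
  \<open>(n, r)\<close>-spanning set, at cost at most \<open>w\<close>. The bound
  \<open>0 \<le> w\<close> is stated separately since \<open>B\<close> may be empty.\<close>

definition small_piece ::
    "('a::metric_space \<Rightarrow> 'a) \<Rightarrow> ('a \<Rightarrow> real) \<Rightarrow> real \<Rightarrow> nat \<Rightarrow> 'a set \<Rightarrow> real \<Rightarrow> bool" where
  "small_piece f a r n B w \<longleftrightarrow> 0 \<le> w
     \<and> (\<forall>x\<in>B. \<forall>y\<in>B. \<forall>i<n. dist ((f ^^ i) x) ((f ^^ i) y) < r)
     \<and> (\<forall>x\<in>B. orbit_prod f a n x \<le> w)"

text \<open>The last argument bounds the total weight of the finitely many pieces.\<close>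

inductive covered ::
    "('a::metric_space \<Rightarrow> 'a) \<Rightarrow> ('a \<Rightarrow> real) \<Rightarrow> real \<Rightarrow> nat \<Rightarrow> 'a set \<Rightarrow> real \<Rightarrow> bool"
  for f a r n where
  covered_empty: "0 \<le> s \<Longrightarrow> covered f a r n {} s"
| covered_step: "small_piece f a r n B w \<Longrightarrow> covered f a r n A s \<Longrightarrow> A' \<subseteq> B \<union> A \<Longrightarrow> w + s \<le> s'
    \<Longrightarrow> covered f a r n A' s'"

lemma covered_mono:
  assumes "covered f a r n A s" "A' \<subseteq> A" "s \<le> s'"
  shows "covered f a r n A' s'"
  using assms
proof cases
  case covered_empty
  then show ?thesis using assms by (auto intro!: covered.covered_empty)
next
  case (covered_step B w A0 s0)
  then show ?thesis using assms by (auto intro!: covered.covered_step[of f a r n B w A0 s0 A' s'])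
qed

lemma covered_Un:
  assumes "covered f a r n A s" "covered f a r n B t"
  shows "covered f a r n (A \<union> B) (s + t)"
  using assms(1)
proof (induction rule: covered.induct)
  case (covered_empty s)
  then show ?case using covered_mono[OF assms(2)] by simp
next
  case (covered_step C w A s A' s')
  show ?case
    by (rule covered.covered_step[OF covered_step.hyps(1) covered_step.IH]) (use covered_step.hyps in auto)
qed

text \<open>Concatenation: \<open>B\<close> controls the first \<open>m\<close> steps of the orbit
  and \<open>C\<close> the following \<open>n\<close>, and the weights multiply by
  \<open>orbit_prod_add\<close>.\<close>

lemma small_piece_Int_vimage:
  assumes pos: "\<And>x. a x > 0" and B: "small_piece f a r m B w" and C: "small_piece f a r n C v"
  shows "small_piece f a r (m + n) (B \<inter> (f ^^ m) -` C) (w * v)"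
  unfolding small_piece_def
proof (intro conjI ballI allI impI)
  show "0 \<le> w * v"
    using B C by (simp add: small_piece_def)
next
  fix x y i
  assume xy: "x \<in> B \<inter> (f ^^ m) -` C" "y \<in> B \<inter> (f ^^ m) -` C" and i: "i < m + n"
  show "dist ((f ^^ i) x) ((f ^^ i) y) < r"
  proof (cases "i < m")
    case True
    then show ?thesis using B xy by (auto simp: small_piece_def)
  next
    case False
    then have "(f ^^ i) z = (f ^^ (i - m)) ((f ^^ m) z)" for z
      by (metis add_diff_inverse_nat comp_apply funpow_add add.commute)
    then show ?thesis using C xy i False by (auto simp: small_piece_def)
  qed
next
  fix x
  assume "x \<in> B \<inter> (f ^^ m) -` C"
  then show "orbit_prod f a (m + n) x \<le> w * v"
    using B C orbit_prod_pos[of a f, OF pos] unfolding orbit_prod_add small_piece_def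
    by (intro mult_mono) (auto intro: less_imp_le)
qed

lemma covered_Int_vimage:
  assumes pos: "\<And>x. a x > 0" and B: "small_piece f a r m B w" and A: "covered f a r n A s"
  shows "covered f a r (m + n) (B \<inter> (f ^^ m) -` A) (w * s)"
  using A
proof (induction rule: covered.induct)
  case (covered_empty s)
  then show ?case
    using B by (auto simp: small_piece_def intro!: covered.covered_empty)
next
  case (covered_step C v A s A' s')
  have "w * v + w * s \<le> w * s'"
    using B covered_step.hyps by (simp add: small_piece_def mult_left_mono flip: distrib_left)
  with covered_step show ?case
    by (intro covered.covered_step[OF small_piece_Int_vimage[OF pos B covered_step.hyps(1)] covered_step.IH]) auto
qed

lemma covered_UN_Int_vimage:
  assumes pos: "\<And>x. a x > 0" and "finite I" and B: "\<And>i. i \<in> I \<Longrightarrow> small_piece f a r m (B i) (w i)"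
    and A: "covered f a r n A s"
  shows "covered f a r (m + n) ((\<Union>i\<in>I. B i) \<inter> (f ^^ m) -` A) ((\<Sum>i\<in>I. w i) * s)"
  using assms(2) B
proof (induction I rule: finite_induct)
  case empty
  then show ?case by (auto intro: covered_empty)
next
  case (insert i I)
  from insert covered_Un[OF covered_Int_vimage[OF pos insert.prems[of i] A] insert.IH]
  show ?case by (auto simp: Int_Un_distrib2 distrib_right)
qed

text \<open>One-step pieces are iterated. This crude count serves for segments shorter than
  \<open>m\<close> and for the existence of finite spanning sets.\<close>

lemma covered_UNIV_power:
  assumes pos: "\<And>x. a x > 0" and "finite J" and D: "\<And>j. j \<in> J \<Longrightarrow> small_piece f a r 1 (D j) (v j)"
    and UN: "(\<Union>j\<in>J. D j) = UNIV"
  shows "covered f a r n UNIV ((\<Sum>j\<in>J. v j) ^ n)"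
proof (induction n)
  case 0
  have "small_piece f a r 0 UNIV 1"
    by (simp add: small_piece_def orbit_prod_def)
  then show ?case
    by (intro covered_step[OF _ covered_empty[of 0]]) auto
next
  case (Suc n)
  from covered_UN_Int_vimage[of a J f r 1 D v n, OF pos assms(2) D Suc] show ?case
    by (simp add: UN)
qed

text \<open>One point is picked from each nonempty piece; its orbit product is at most the weight of
  the piece.\<close>

lemma covered_imp_spanning_set:
  assumes pos: "\<And>x. a x > 0" and "covered f a r n A s"
  shows "\<exists>E. finite E \<and> (\<forall>x\<in>A. \<exists>y\<in>E. \<forall>i<n. dist ((f ^^ i) x) ((f ^^ i) y) < r)
     \<and> (\<Sum>y\<in>E. orbit_prod f a n y) \<le> s"
  using assms(2)
proof (induction rule: covered.induct)
  case (covered_empty s)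
  then show ?case by (intro exI[of _ "{}"]) auto
next
  case (covered_step B w A s A' s')
  obtain E where E: "finite E" "\<forall>x\<in>A. \<exists>y\<in>E. \<forall>i<n. dist ((f ^^ i) x) ((f ^^ i) y) < r"
    "(\<Sum>y\<in>E. orbit_prod f a n y) \<le> s"
    using covered_step.IH by blast
  show ?case
  proof (cases "B = {}")
    case True
    then show ?thesis
      using E covered_step.hyps by (intro exI[of _ E]) (auto simp: small_piece_def subset_iff)
  next
    case False
    then obtain z where z: "z \<in> B" by auto
    have "(\<Sum>y\<in>insert z E. orbit_prod f a n y) \<le> orbit_prod f a n z + (\<Sum>y\<in>E. orbit_prod f a n y)"
      using E(1) orbit_prod_pos[of a f n z, OF pos] by (cases "z \<in> E") (simp_all add: insert_absorb)
    also have "\<dots> \<le> w + s"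
      using E(3) z covered_step.hyps(1) by (intro add_mono) (auto simp: small_piece_def)
    finally have "(\<Sum>y\<in>insert z E. orbit_prod f a n y) \<le> s'"
      using covered_step.hyps by simp
    moreover have "\<exists>y\<in>insert z E. \<forall>i<n. dist ((f ^^ i) x) ((f ^^ i) y) < r" if "x \<in> A'" for x
    proof (cases "x \<in> B")
      case True
      then show ?thesis using z covered_step.hyps(1) by (auto simp: small_piece_def)
    next
      case False
      then have "x \<in> A" using that covered_step.hyps by auto
      then show ?thesis using E(2) by blast
    qed
    ultimately show ?thesis
      using E(1) by (intro exI[of _ "insert z E"]) simp
  qed
qed

text \<open>Orbit segments of length \<open>m\<close> are coded by the pieces \<open>B i\<close> when they start in \<open>U\<close>; each of the at
  most \<open>k\<close> excursions out of \<open>U\<close> costs one step coded by a piece \<open>D j\<close> and a factor \<open>1 / \<eta>\<close>.\<close>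

lemma covered_few_visits:
  assumes pos: "\<And>x. a x > 0"
    and I: "finite I" "\<And>i. i \<in> I \<Longrightarrow> small_piece f a r m (B i) (w i)" "U \<subseteq> (\<Union>i\<in>I. B i)"
    and J: "finite J" "\<And>j. j \<in> J \<Longrightarrow> small_piece f a r 1 (D j) (v j)" "(\<Union>j\<in>J. D j) = UNIV"
    and m: "m > 0" and \<Lambda>: "\<Lambda> > 0" and \<eta>: "0 < \<eta>" "\<eta> \<le> 1" and C: "C \<ge> 0"
    and rate: "(\<Sum>i\<in>I. w i) / \<Lambda> ^ m + \<eta> * (\<Sum>j\<in>J. v j) / \<Lambda> \<le> 1"
    and init: "\<And>n. n < m \<Longrightarrow> (\<Sum>j\<in>J. v j) ^ n \<le> C * \<Lambda> ^ n"
  shows "covered f a r n {x. visits f (-U) n x \<le> k} (C * \<Lambda> ^ n / \<eta> ^ k)"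
proof (induction n arbitrary: k rule: less_induct)
  case (less n)
  define Q where "Q = (\<Sum>i\<in>I. w i)"
  define T where "T = (\<Sum>j\<in>J. v j)"
  have T0: "T \<ge> 0"
    using J(2) unfolding T_def by (intro sum_nonneg) (auto simp: small_piece_def)
  show ?case
  proof (cases "n < m")
    case True
    have "T ^ n \<le> C * \<Lambda> ^ n"
      using init[OF True] by (simp add: T_def)
    also have "\<dots> \<le> C * \<Lambda> ^ n / \<eta> ^ k"
      using C \<Lambda> \<eta> by (simp add: le_divide_eq power_le_one mult_left_le)
    finally show ?thesis
      unfolding T_def
      by (intro covered_mono[OF covered_UNIV_power[of a J f r D v n, OF pos J]]) auto
  next
    case False
    then have n: "m + (n - m) = n" "1 + (n - 1) = n" "n - m < n" "n - 1 < n"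
      using m by auto
    let ?s1 = "C * \<Lambda> ^ (n - m) / \<eta> ^ k"
    have c1: "covered f a r n ((\<Union>i\<in>I. B i) \<inter> (f ^^ m) -` {x. visits f (-U) (n - m) x \<le> k}) (Q * ?s1)"
      using covered_UN_Int_vimage[of a I f r m B w "n - m", OF pos I(1,2) less.IH[OF n(3)]] n(1)
      by (simp add: Q_def)
    have visits_m: "visits f (-U) (n - m) ((f ^^ m) x) \<le> visits f (-U) n x" for x
      using visits_add[of f "-U" m "n - m" x] n(1) by simp
    have visits_1: "visits f (-U) n x = visits f (-U) (n - 1) (f x) + 1" if "x \<notin> U" for x
      using visits_Suc[of f "-U" "n - 1" x] n(2) that by simp
    have "\<Lambda> ^ n = \<Lambda> ^ m * \<Lambda> ^ (n - m)"
      using n(1) by (metis power_add)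
    then have eq1: "Q * ?s1 = C * \<Lambda> ^ n / \<eta> ^ k * (Q / \<Lambda> ^ m)"
      using \<Lambda> by simp
    \<comment> \<open>Both branches of the recursion are fractions of the target weight, and by
      \<open>rate\<close> the fractions sum to at most 1.\<close>
    have rate': "C * \<Lambda> ^ n / \<eta> ^ k * (Q / \<Lambda> ^ m + \<eta> * T / \<Lambda>) \<le> C * \<Lambda> ^ n / \<eta> ^ k"
      using rate C \<Lambda> \<eta> by (intro mult_left_le) (auto simp: Q_def T_def)
    show ?thesis
    proof (cases k)
      case 0
      \<comment> \<open>Here \<open>n \<ge> m > 0\<close>, so time 0 is counted: with no excursion
        left, the orbit starts in \<open>U\<close>.\<close>
      have "{x. visits f (-U) n x \<le> k} \<subseteq> (\<Union>i\<in>I. B i) \<inter> (f ^^ m) -` {x. visits f (-U) (n - m) x \<le> k}"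
      proof
        fix x
        assume "x \<in> {x. visits f (-U) n x \<le> k}"
        then have "visits f (-U) n x = 0" using 0 by simp
        then show "x \<in> (\<Union>i\<in>I. B i) \<inter> (f ^^ m) -` {x. visits f (-U) (n - m) x \<le> k}"
          using visits_m[of x] visits_1[of x] I(3) by (cases "x \<in> U") auto
      qed
      moreover have "C * \<Lambda> ^ n / \<eta> ^ k * (\<eta> * T / \<Lambda>) \<ge> 0"
        using C \<Lambda> \<eta> T0 by simp
      then have "Q * ?s1 \<le> C * \<Lambda> ^ n / \<eta> ^ k"
        using rate' unfolding eq1 distrib_left by linarith
      ultimately show ?thesis
        by (rule covered_mono[OF c1])
    next
      case (Suc k')
      \<comment> \<open>A start outside \<open>U\<close> uses up one excursion, so the exponent of
        \<eta> drops by one. This accounts for the factor \<eta> in \<open>rate\<close>.\<close>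
      let ?s2 = "C * \<Lambda> ^ (n - 1) / \<eta> ^ k'"
      have c2: "covered f a r n ((\<Union>j\<in>J. D j) \<inter> (f ^^ 1) -` {x. visits f (-U) (n - 1) x \<le> k'}) (T * ?s2)"
        using covered_UN_Int_vimage[of a J f r 1 D v "n - 1", OF pos J(1,2) less.IH[OF n(4)]] n(2)
        by (simp add: T_def)
      have "{x. visits f (-U) n x \<le> k} \<subseteq> (\<Union>i\<in>I. B i) \<inter> (f ^^ m) -` {x. visits f (-U) (n - m) x \<le> k} \<union>
          (\<Union>j\<in>J. D j) \<inter> (f ^^ 1) -` {x. visits f (-U) (n - 1) x \<le> k'}"
      proof
        fix x
        assume x: "x \<in> {x. visits f (-U) n x \<le> k}"
        show "x \<in> (\<Union>i\<in>I. B i) \<inter> (f ^^ m) -` {x. visits f (-U) (n - m) x \<le> k} \<union>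
          (\<Union>j\<in>J. D j) \<inter> (f ^^ 1) -` {x. visits f (-U) (n - 1) x \<le> k'}"
        proof (cases "x \<in> U")
          case True
          then have "x \<in> (\<Union>i\<in>I. B i)" using I(3) by auto
          moreover have "visits f (-U) (n - m) ((f ^^ m) x) \<le> k"
            using x visits_m[of x] by simp
          ultimately show ?thesis by auto
        next
          case False
          then show ?thesis using x visits_1[of x] Suc by (simp add: J(3))
        qed
      qed
      moreover have "\<Lambda> ^ n = \<Lambda> * \<Lambda> ^ (n - 1)"
        using n(2) by (metis plus_1_eq_Suc power_Suc)
      then have "T * ?s2 = C * \<Lambda> ^ n / \<eta> ^ k * (\<eta> * T / \<Lambda>)"
        using \<Lambda> \<eta> Suc by (simp add: field_simps)
      then have "Q * ?s1 + T * ?s2 \<le> C * \<Lambda> ^ n / \<eta> ^ k"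
        using rate' unfolding eq1 distrib_left by linarith
      ultimately show ?thesis
        by (rule covered_mono[OF covered_Un[OF c1 c2]])
    qed
  qed
qed

lemma open_dyn_ball:
  fixes f :: "'a::metric_space \<Rightarrow> 'a"
  assumes f: "continuous_on UNIV f"
  shows "open {x. \<forall>i<n. dist ((f ^^ i) x) ((f ^^ i) y) < \<epsilon>}"
proof -
  have cont: "continuous_on UNIV (f ^^ i)" for i
  proof (induction i)
    case (Suc i)
    then show ?case
      using continuous_on_compose2[OF f Suc] by (simp add: comp_def)
  qed (simp add: continuous_on_id)
  have "open {x. dist ((f ^^ i) x) ((f ^^ i) y) < \<epsilon>}" for i
    by (intro open_Collect_less continuous_on_dist cont continuous_on_const)
  moreover have "{x. \<forall>i<n. dist ((f ^^ i) x) ((f ^^ i) y) < \<epsilon>} = (\<Inter>i<n. {x. dist ((f ^^ i) x) ((f ^^ i) y) < \<epsilon>})"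
    by auto
  ultimately show ?thesis by (simp add: open_INT)
qed

lemma compact_finite_unit_pieces:
  fixes f :: "'a::metric_space \<Rightarrow> 'a"
  assumes cpt: "compact (UNIV :: 'a set)" and pos: "\<And>x. a x > 0" and \<epsilon>: "\<epsilon> > 0"
    and near: "\<And>x y. dist x y < \<epsilon> \<Longrightarrow> a x \<le> \<kappa> * a y"
  shows "\<exists>J. finite J \<and> (\<Union>j\<in>J. ball j \<epsilon>) = UNIV
    \<and> (\<forall>j\<in>J. small_piece f a (2 * \<epsilon>) 1 (ball j \<epsilon>) (\<kappa> * a j))"
proof -
  obtain J :: "'a set" where J: "finite J" "UNIV \<subseteq> (\<Union>j\<in>J. ball j \<epsilon>)"
    using compactE_image[OF cpt, of UNIV "\<lambda>j. ball j \<epsilon>"] \<epsilon> by (metis UNIV_I UN_I centre_in_ball open_ball subsetI)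
  have "small_piece f a (2 * \<epsilon>) 1 (ball j \<epsilon>) (\<kappa> * a j)" for j
    unfolding small_piece_def
  proof (intro conjI ballI allI impI)
    \<comment> \<open>No sign of \<kappa> is assumed; nonnegativity of the weight comes from
      \<open>near\<close> applied to \<open>j\<close> and itself.\<close>
    have "0 < a j" by (rule pos)
    also have "a j \<le> \<kappa> * a j" using \<epsilon> by (intro near) simp
    finally show "0 \<le> \<kappa> * a j" by simp
  next
    fix x y i
    assume "x \<in> ball j \<epsilon>" "y \<in> ball j \<epsilon>" "i < (1::nat)"
    then show "dist ((f ^^ i) x) ((f ^^ i) y) < 2 * \<epsilon>"
      using dist_triangle3[of x y j] by simp
  next
    fix x
    assume "x \<in> ball j \<epsilon>"
    then show "orbit_prod f a 1 x \<le> \<kappa> * a j"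
      by (simp add: orbit_prod_def near dist_commute)
  qed
  then show ?thesis
    using J by blast
qed

text \<open>Coding for the constant function 1; balls of half the radius make the pieces
  \<epsilon>-small.\<close>

lemma ex_finite_spanning:
  fixes f :: "'a::metric_space \<Rightarrow> 'a"
  assumes cpt: "compact (UNIV :: 'a set)" and \<epsilon>: "\<epsilon> > 0"
  shows "\<exists>E. finite E \<and> (\<forall>x. \<exists>y\<in>E. \<forall>i<n. dist ((f ^^ i) x) ((f ^^ i) y) < \<epsilon>)"
proof -
  obtain J :: "'a set" where J: "finite J" "(\<Union>j\<in>J. ball j (\<epsilon>/2)) = UNIV"
    "\<And>j. j \<in> J \<Longrightarrow> small_piece f (\<lambda>_. 1) (2 * (\<epsilon>/2)) 1 (ball j (\<epsilon>/2)) (1 * 1)"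
    using compact_finite_unit_pieces[OF cpt, of "\<lambda>_. 1" "\<epsilon>/2" 1 f] \<epsilon> by auto
  have "covered f (\<lambda>_. 1) \<epsilon> n UNIV ((\<Sum>j\<in>J. 1) ^ n)"
    using J by (intro covered_UNIV_power[where D = "\<lambda>j. ball j (\<epsilon>/2)"]) auto
  from covered_imp_spanning_set[OF _ this] show ?thesis
    by auto
qed

text \<open>A finite set that spans the essential set up to time \<open>m\<close> also codes orbits
  starting in a neighborhood \<open>U\<close> of it, and excursions out of \<open>U\<close> are
  rare. The three factors \<kappa> pay for the variation of \<open>a\<close> on the pieces, for the
  gap that leaves room for excursions in the rate condition, and for the factors
  \<open>1 / \<eta>\<close>.\<close>

lemma eventually_spanning_sum_le:
  fixes f :: "'a::metric_space \<Rightarrow> 'a"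
  assumes cpt: "compact (UNIV :: 'a set)" and f: "continuous_on UNIV f"
    and pos: "\<And>x. a x > 0" and \<epsilon>: "\<epsilon> > 0" and \<kappa>: "\<kappa> > 1"
    and near: "\<And>x y. dist x y < \<epsilon> \<Longrightarrow> a x \<le> \<kappa> * a y"
    and m: "m > 0" and E: "finite E"
    and span: "\<And>x. x \<in> essential_set f \<Longrightarrow> \<exists>y\<in>E. \<forall>i<m. dist ((f ^^ i) x) ((f ^^ i) y) < \<epsilon>"
  obtains C where "C > 0" "\<forall>\<^sub>F n in sequentially. \<exists>E'. finite E'
    \<and> (\<forall>x. \<exists>y\<in>E'. \<forall>i<n. dist ((f ^^ i) x) ((f ^^ i) y) < 2 * \<epsilon>)
    \<and> (\<Sum>y\<in>E'. orbit_prod f a n y) \<le> C * (\<kappa> ^ 3 * root m (\<Sum>y\<in>E. orbit_prod f a m y)) ^ n"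
proof -
  define s where "s = (\<Sum>y\<in>E. orbit_prod f a m y)"
  have "E \<noteq> {}"
    using span essential_set_nonempty[OF cpt f] by auto
  then have s: "s > 0"
    unfolding s_def using E orbit_prod_pos[of a f m, OF pos] by (intro sum_pos) auto
  define B where "B y = {x. \<forall>i<m. dist ((f ^^ i) x) ((f ^^ i) y) < \<epsilon>}" for y
  define U where "U = (\<Union>y\<in>E. B y)"
  have U: "open U" "essential_set f \<subseteq> U"
    using span open_dyn_ball[OF f] by (auto simp: U_def B_def)
  have B: "small_piece f a (2 * \<epsilon>) m (B y) (\<kappa> ^ m * orbit_prod f a m y)" for y
    unfolding small_piece_def
  proof (intro conjI ballI allI impI)
    show "0 \<le> \<kappa> ^ m * orbit_prod f a m y"
      using \<kappa> orbit_prod_pos[of a f m y, OF pos] by simp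
  next
    fix x z i
    assume "x \<in> B y" "z \<in> B y" "i < m"
    then have "dist ((f ^^ i) x) ((f ^^ i) y) < \<epsilon>" "dist ((f ^^ i) z) ((f ^^ i) y) < \<epsilon>"
      by (auto simp: B_def)
    then show "dist ((f ^^ i) x) ((f ^^ i) z) < 2 * \<epsilon>"
      using dist_triangle2[of "(f ^^ i) x" "(f ^^ i) z" "(f ^^ i) y"] by simp
  next
    fix x
    assume "x \<in> B y"
    then show "orbit_prod f a m x \<le> \<kappa> ^ m * orbit_prod f a m y"
      by (intro orbit_prod_le_power pos near) (auto simp: B_def)
  qed
  have "\<exists>J. finite J \<and> (\<Union>j\<in>J. ball j \<epsilon>) = UNIV
    \<and> (\<forall>j\<in>J. small_piece f a (2 * \<epsilon>) 1 (ball j \<epsilon>) (\<kappa> * a j))"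
    by (rule compact_finite_unit_pieces[OF cpt pos \<epsilon> near])
  then obtain J where "finite J \<and> (\<Union>j\<in>J. ball j \<epsilon>) = UNIV
    \<and> (\<forall>j\<in>J. small_piece f a (2 * \<epsilon>) 1 (ball j \<epsilon>) (\<kappa> * a j))" ..
  then have J: "finite J" "(\<Union>j\<in>J. ball j \<epsilon>) = UNIV"
    "\<And>j. j \<in> J \<Longrightarrow> small_piece f a (2 * \<epsilon>) 1 (ball j \<epsilon>) (\<kappa> * a j)"
    by simp_all
  define T where "T = (\<Sum>j\<in>J. \<kappa> * a j)"
  have T0: "T \<ge> 0"
    unfolding T_def using \<kappa> pos by (intro sum_nonneg) (auto intro: less_imp_le)
  define \<Lambda> where "\<Lambda> = \<kappa> ^ 2 * root m s"
  have \<Lambda>: "\<Lambda> > 0"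
    using s m \<kappa> by (simp add: \<Lambda>_def)
  have \<Lambda>m: "\<Lambda> ^ m = \<kappa> ^ (2 * m) * s"
    using s m by (simp add: \<Lambda>_def power_mult_distrib power_mult)
  have Q: "(\<Sum>y\<in>E. \<kappa> ^ m * orbit_prod f a m y) / \<Lambda> ^ m = 1 / \<kappa> ^ m"
    using \<kappa> s unfolding sum_distrib_left[symmetric] s_def[symmetric] \<Lambda>m
    by (simp add: power_mult mult_2 power_add)
  have gap: "1 - 1 / \<kappa> ^ m > 0"
    using \<kappa> m by simp
  \<comment> \<open>The excursions must fit into the gap \<open>1 - 1 / \<kappa> ^ m\<close>. The
    denominator \<open>T + 1\<close> is positive, and the bound \<open>1/2\<close> makes
    \<open>ln (1 / \<eta>)\<close> positive for the choice of \<delta> below.\<close>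
  define \<eta> where "\<eta> = min (1/2) ((1 - 1 / \<kappa> ^ m) * \<Lambda> / (T + 1))"
  have \<eta>: "0 < \<eta>" "\<eta> \<le> 1/2" and \<eta>_le: "\<eta> \<le> (1 - 1 / \<kappa> ^ m) * \<Lambda> / (T + 1)"
    unfolding \<eta>_def using gap \<Lambda> T0 by (simp_all only: min_less_iff_conj min.cobounded1 min.cobounded2) simp_all
  have "\<eta> * T / \<Lambda> \<le> (1 - 1 / \<kappa> ^ m) * \<Lambda> / (T + 1) * (T + 1) / \<Lambda>"
    using \<eta> T0 \<Lambda> by (intro divide_right_mono mult_mono \<eta>_le order_trans[OF less_imp_le[OF \<eta>(1)] \<eta>_le]) auto
  also have "\<dots> = 1 - 1 / \<kappa> ^ m"
    using T0 \<Lambda> by simp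
  finally have rate: "(\<Sum>y\<in>E. \<kappa> ^ m * orbit_prod f a m y) / \<Lambda> ^ m + \<eta> * T / \<Lambda> \<le> 1"
    unfolding Q by simp
  \<comment> \<open>\<open>C\<close> absorbs the finitely many lengths below
    \<open>m\<close>.\<close>
  define C where "C = (\<Sum>n<m. T ^ n / \<Lambda> ^ n) + 1"
  have C: "C > 0"
    unfolding C_def using T0 \<Lambda> by (intro add_nonneg_pos sum_nonneg) auto
  have init: "T ^ n \<le> C * \<Lambda> ^ n" if "n < m" for n
  proof -
    have "T ^ n / \<Lambda> ^ n \<le> (\<Sum>n<m. T ^ n / \<Lambda> ^ n)"
      using that T0 \<Lambda> by (intro member_le_sum) auto
    then have "T ^ n / \<Lambda> ^ n \<le> C" by (simp add: C_def)
    then show ?thesis using \<Lambda> by (simp add: divide_le_eq)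
  qed
  have cov: "covered f a (2 * \<epsilon>) n {x. visits f (-U) n x \<le> k} (C * \<Lambda> ^ n / \<eta> ^ k)" for n k
    using \<eta> C init rate
    by (intro covered_few_visits[where I = E and B = B and J = J and D = "\<lambda>j. ball j \<epsilon>"
          and w = "\<lambda>y. \<kappa> ^ m * orbit_prod f a m y" and v = "\<lambda>j. \<kappa> * a j", OF pos E B _ J(1,3,2) m \<Lambda>])
      (auto simp: U_def T_def)
  \<comment> \<open>The frequency at which \<open>k \<le> \<delta> * n\<close> excursions cost at
    most \<open>\<kappa> ^ n\<close>. It is fixed before \<open>n\<close>, since \<eta> depends only
    on the coding data.\<close>
  define \<delta> where "\<delta> = ln \<kappa> / ln (1 / \<eta>)"
  have \<delta>: "\<delta> > 0"
    using \<kappa> \<eta> unfolding \<delta>_def by (intro divide_pos_pos) auto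
  have "\<forall>\<^sub>F n in sequentially. \<forall>x. real (visits f (-U) n x) < \<delta> * real n"
    by (rule eventually_few_visits_outside[OF cpt f U \<delta>])
  then have "\<forall>\<^sub>F n in sequentially. \<exists>E'. finite E'
    \<and> (\<forall>x. \<exists>y\<in>E'. \<forall>i<n. dist ((f ^^ i) x) ((f ^^ i) y) < 2 * \<epsilon>)
    \<and> (\<Sum>y\<in>E'. orbit_prod f a n y) \<le> C * (\<kappa> ^ 3 * root m s) ^ n"
  proof eventually_elim
    case (elim n)
    define k where "k = nat \<lfloor>\<delta> * real n\<rfloor>"
    have "visits f (-U) n x \<le> k" for x
      using elim[rule_format, of x] unfolding k_def by linarith
    then have all: "{x. visits f (-U) n x \<le> k} = UNIV" by auto
    have k: "real k \<le> \<delta> * real n"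
      using \<delta> unfolding k_def by simp
    have "(1 / \<eta>) ^ k = exp (real k * ln (1 / \<eta>))"
      using \<eta> by (simp add: exp_of_nat_mult)
    also have "\<dots> \<le> exp (\<delta> * real n * ln (1 / \<eta>))"
      using k \<eta> by (intro exp_mono mult_right_mono) (auto simp: ln_div)
    also have "\<dots> = \<kappa> ^ n"
      using \<kappa> \<eta> by (simp add: \<delta>_def ln_div exp_of_nat_mult mult.commute)
    finally have "(1 / \<eta>) ^ k \<le> \<kappa> ^ n" .
    then have "C * \<Lambda> ^ n * (1 / \<eta>) ^ k \<le> C * \<Lambda> ^ n * \<kappa> ^ n"
      using C \<Lambda> by (intro mult_left_mono) auto
    also have "\<dots> = C * (\<kappa> ^ 3 * root m s) ^ n"
      by (simp add: \<Lambda>_def power_mult_distrib eval_nat_numeral mult_ac)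
    finally have "covered f a (2 * \<epsilon>) n UNIV (C * (\<kappa> ^ 3 * root m s) ^ n)"
      using covered_mono[OF cov[of n k]] by (simp add: all power_one_over)
    from covered_imp_spanning_set[OF pos this] show ?case
      by auto
  qed
  then show thesis
    using that C unfolding s_def by blast
qed

subsection \<open>Fibers and Fekete's lemma\<close>

text \<open>\<rho> is a Lebesgue number of the cover of \<open>S\<close> by open sets on which
  \<open>f\<close> is injective within \<open>S\<close>.\<close>

lemma separated_fibers:
  fixes f :: "'a::metric_space \<Rightarrow> 'a"
  assumes S: "compact S" and lh: "local_homeomorphism_on S f"
  shows "\<exists>\<rho>>0. \<forall>y\<in>S. \<forall>y'\<in>S. f y = f y' \<longrightarrow> dist y y' < \<rho> \<longrightarrow> y = y'"
proof -
  define \<T> where "\<T> = {T. open T \<and> inj_on f (S \<inter> T)}"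
  have "S \<subseteq> \<Union>\<T>"
  proof
    fix x assume "x \<in> S"
    then obtain U V g where U: "x \<in> U" "openin (top_of_set S) U" "homeomorphism U V f g"
      using lh unfolding local_homeomorphism_on_def by blast
    then obtain T where T: "open T" "U = S \<inter> T"
      by (auto simp: openin_open)
    have "inj_on f U"
      using U(3) by (metis homeomorphism_def inj_onI)
    then show "x \<in> \<Union>\<T>"
      using T U(1) by (auto simp: \<T>_def)
  qed
  then obtain \<rho> where \<rho>: "0 < \<rho>" "\<And>x. x \<in> S \<Longrightarrow> \<exists>T\<in>\<T>. ball x \<rho> \<subseteq> T"
    using Heine_Borel_lemma[OF S] unfolding \<T>_def by (metis (no_types, lifting) mem_Collect_eq)
  show ?thesis
  proof (intro exI[of _ \<rho>] conjI ballI impI \<rho>(1))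
    fix y y'
    assume y: "y \<in> S" "y' \<in> S" "f y = f y'" "dist y y' < \<rho>"
    obtain T where "inj_on f (S \<inter> T)" "ball y \<rho> \<subseteq> T"
      using \<rho>(2)[OF y(1)] by (auto simp: \<T>_def)
    then show "y = y'"
      using y \<rho>(1) by (auto simp: inj_on_def subset_iff)
  qed
qed

text \<open>Induction from the front: \<open>f y\<close> and \<open>f y'\<close> have a common image
  after one step less and remain close until then, hence are equal; closeness at time 0 then
  identifies \<open>y\<close> and \<open>y'\<close>.\<close>

lemma fiber_separated:
  assumes sep: "\<And>y y'. y \<in> S \<Longrightarrow> y' \<in> S \<Longrightarrow> f y = f y' \<Longrightarrow> dist y y' < \<rho> \<Longrightarrow> y = y'"
    and inv: "\<And>y. y \<in> S \<Longrightarrow> f y \<in> S"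
  shows "y \<in> S \<Longrightarrow> y' \<in> S \<Longrightarrow> (f ^^ n) y = (f ^^ n) y' \<Longrightarrow>
    (\<And>i. i < n \<Longrightarrow> dist ((f ^^ i) y) ((f ^^ i) y') < \<rho>) \<Longrightarrow> y = y'"
proof (induction n arbitrary: y y')
  case (Suc n)
  have "dist ((f ^^ i) (f y)) ((f ^^ i) (f y')) < \<rho>" if "i < n" for i
    using Suc.prems(4)[of "Suc i"] that by (simp add: funpow_swap1)
  then have "f y = f y'"
    using Suc.prems inv by (intro Suc.IH[of "f y" "f y'"]) (simp_all add: funpow_swap1)
  moreover have "dist y y' < \<rho>"
    using Suc.prems(4)[of 0] by simp
  ultimately show ?case
    using Suc.prems sep by blast
qed simp

text \<open>Two points of a fiber followed by the same point of \<open>E\<close> stay within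
  \<open>2 * \<epsilon> \<le> \<rho>\<close> of each other, hence coincide.\<close>

lemma fiber_injection:
  assumes sep: "\<And>y y'. y \<in> S \<Longrightarrow> y' \<in> S \<Longrightarrow> f y = f y' \<Longrightarrow> dist y y' < \<rho> \<Longrightarrow> y = y'"
    and inv: "\<And>y. y \<in> S \<Longrightarrow> f y \<in> S"
    and \<epsilon>: "2 * \<epsilon> \<le> \<rho>" and pos: "\<And>x. a x > 0"
    and near: "\<And>x y. dist x y < \<epsilon> \<Longrightarrow> a x \<le> \<kappa> * a y"
    and span: "\<And>x. x \<in> S \<Longrightarrow> \<exists>y\<in>E. \<forall>i<n. dist ((f ^^ i) x) ((f ^^ i) y) < \<epsilon>"
  obtains g where "inj_on g ((f ^^ n) -` {x} \<inter> S)" "g ` ((f ^^ n) -` {x} \<inter> S) \<subseteq> E"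
    "\<And>y. y \<in> S \<Longrightarrow> orbit_prod f a n y \<le> \<kappa> ^ n * orbit_prod f a n (g y)"
proof -
  obtain g where g: "\<And>y. y \<in> S \<Longrightarrow> g y \<in> E"
      "\<And>y i. y \<in> S \<Longrightarrow> i < n \<Longrightarrow> dist ((f ^^ i) y) ((f ^^ i) (g y)) < \<epsilon>"
    using span by metis
  show thesis
  proof (rule that[of g])
    show "inj_on g ((f ^^ n) -` {x} \<inter> S)"
    proof (intro inj_onI)
      fix y y'
      assume y: "y \<in> (f ^^ n) -` {x} \<inter> S" "y' \<in> (f ^^ n) -` {x} \<inter> S" "g y = g y'"
      have "dist ((f ^^ i) y) ((f ^^ i) y') < \<rho>" if "i < n" for i
        using g(2)[of y i] g(2)[of y' i] y that \<epsilon>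
          dist_triangle2[of "(f ^^ i) y" "(f ^^ i) y'" "(f ^^ i) (g y)"] by auto
      with y show "y = y'"
        by (intro fiber_separated[of S f \<rho> y y' n, OF sep inv]) auto
    qed
    show "g ` ((f ^^ n) -` {x} \<inter> S) \<subseteq> E"
      using g(1) by auto
    show "orbit_prod f a n y \<le> \<kappa> ^ n * orbit_prod f a n (g y)" if "y \<in> S" for y
      using g(2)[OF that] by (intro orbit_prod_le_power pos near)
  qed
qed

text \<open>Fekete's lemma for the submultiplicative sequence \<open>w n ^ n\<close>. The
  multiplicative form admits zero values; the limit is the infimum over positive indices.\<close>

lemma fekete_root:
  fixes w :: "nat \<Rightarrow> real"
  assumes nonneg: "\<And>n. 0 \<le> w n"
    and sub: "\<And>m n. m > 0 \<Longrightarrow> n > 0 \<Longrightarrow> w (m + n) ^ (m + n) \<le> w m ^ m * w n ^ n"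
  shows "convergent w"
proof -
  have bdd: "bdd_below (w ` {0<..})"
    using nonneg by (auto intro!: bdd_belowI)
  have "w \<longlonglongrightarrow> Inf (w ` {0<..})"
  proof (rule order_tendstoI)
    fix b
    assume "b < Inf (w ` {0<..})"
    then have "b < w n" if "n > 0" for n
      using cInf_lower[OF _ bdd, of "w n"] that by (force intro: less_le_trans)
    then show "\<forall>\<^sub>F n in sequentially. b < w n"
      by (intro eventually_mono[OF eventually_gt_at_top[of "0::nat"]])
  next
    fix b
    assume "Inf (w ` {0<..}) < b"
    then obtain m where m: "m > 0" "w m < b"
      using cInf_lessD[of "w ` {0<..}" b] by auto
    \<comment> \<open>Strictly between \<open>w m\<close> and \<open>b\<close>, to leave room for
      the factor \<open>root n K\<close>, and positive even if \<open>w m = 0\<close>.\<close>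
    define c where "c = (w m + b) / 2"
    have c: "w m < c" "c < b" "c > 0"
      using m nonneg[of m] by (auto simp: c_def)
    have iter: "w (q * m + r) ^ (q * m + r) \<le> (w m ^ m) ^ q * w r ^ r" if "r > 0" for q r
    proof (induction q)
      case (Suc q)
      have "w (m + (q * m + r)) ^ (m + (q * m + r)) \<le> w m ^ m * w (q * m + r) ^ (q * m + r)"
        using m that by (intro sub) auto
      also have "\<dots> \<le> w m ^ m * ((w m ^ m) ^ q * w r ^ r)"
        using Suc nonneg by (intro mult_left_mono) auto
      finally show ?case by (simp add: algebra_simps)
    qed simp
    define K where "K = (\<Sum>r\<in>{1..m}. w r ^ r / c ^ r) + 1"
    have K: "K > 0"
      unfolding K_def using nonneg c by (intro add_nonneg_pos sum_nonneg) auto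
    have upper: "w n \<le> root n K * c" if n: "n > 0" for n
    proof -
      \<comment> \<open>The remainder runs from 1 to \<open>m\<close> instead of 0 to
        \<open>m - 1\<close>, since \<open>sub\<close> requires positive indices.\<close>
      define q r where "q = (n - 1) div m" and "r = (n - 1) mod m + 1"
      have qr: "n = q * m + r"
        using n unfolding q_def r_def by (metis Suc_diff_1 Suc_eq_plus1 add.assoc div_mult_mod_eq)
      have r: "r \<in> {1..m}"
        using m(1) unfolding r_def by (simp add: Suc_leI)
      have "w r ^ r / c ^ r \<le> (\<Sum>r\<in>{1..m}. w r ^ r / c ^ r)"
        using r nonneg c by (intro member_le_sum) auto
      then have "w r ^ r / c ^ r \<le> K" by (simp add: K_def)
      then have wr: "w r ^ r \<le> K * c ^ r"
        using c by (simp add: divide_le_eq)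
      have "w n ^ n \<le> (w m ^ m) ^ q * w r ^ r"
        using iter[of r q] r qr by simp
      also have "\<dots> \<le> (c ^ m) ^ q * (K * c ^ r)"
        using nonneg c wr K by (intro mult_mono power_mono) auto
      also have "\<dots> = K * c ^ n"
        by (simp add: qr power_add mult.commute flip: power_mult)
      finally have "root n (w n ^ n) \<le> root n (K * c ^ n)"
        using n by simp
      then show ?thesis
        using n nonneg c by (simp add: real_root_mult real_root_power_cancel)
    qed
    have "(\<lambda>n. root n K * c) \<longlonglongrightarrow> 1 * c"
      by (intro tendsto_intros LIMSEQ_root_const K)
    then have "\<forall>\<^sub>F n in sequentially. root n K * c < b"
      using c by (simp add: order_tendsto_iff)
    with eventually_gt_at_top[of "0::nat"] show "\<forall>\<^sub>F n in sequentially. w n < b"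
    proof eventually_elim
      case (elim n)
      then show ?case using upper[of n] by simp
    qed
  qed
  then show ?thesis by (auto simp: convergent_def)
qed

subsection \<open>Extended reals and limits over scales\<close>

lemma root_ennreal_ennreal: "0 \<le> x \<Longrightarrow> root_ennreal n (ennreal x) = ennreal (root n x)"
  by (simp add: root_ennreal_def)

text \<open>Roots and powers are adjoint, also at \<infinity>, so that estimates for roots can be
  made on powers.\<close>

lemma root_ennreal_le_iff:
  assumes n: "n > 0"
  shows "root_ennreal n x \<le> y \<longleftrightarrow> x \<le> y ^ n"
proof (cases x rule: ennreal_cases)
  case (real r)
  show ?thesis
  proof (cases y rule: ennreal_cases)
    case (real s)
    have "root n r \<le> s \<longleftrightarrow> r \<le> s ^ n"
    proof
      assume "root n r \<le> s"
      then have "root n r ^ n \<le> s ^ n"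
        using n \<open>0 \<le> r\<close> by (intro power_mono) auto
      then show "r \<le> s ^ n" using n \<open>0 \<le> r\<close> by simp
    next
      assume "r \<le> s ^ n"
      then have "root n r \<le> root n (s ^ n)" using n by simp
      then show "root n r \<le> s" using n real by (simp add: real_root_power_cancel)
    qed
    then show ?thesis
      using real \<open>x = ennreal r\<close> \<open>0 \<le> r\<close> by (simp add: root_ennreal_ennreal ennreal_power)
  next
    case top
    then show ?thesis using n by simp
  qed
next
  case top
  then show ?thesis using n by (auto simp: root_ennreal_def top_unique power_eq_top_ennreal)
qed

lemma le_root_ennreal_power: "n > 0 \<Longrightarrow> x \<le> root_ennreal n x ^ n"
  using root_ennreal_le_iff[of n x "root_ennreal n x"] by simp

lemma root_ennreal_mono: "n > 0 \<Longrightarrow> x \<le> y \<Longrightarrow> root_ennreal n x \<le> root_ennreal n y"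
  by (meson le_root_ennreal_power order_trans root_ennreal_le_iff)

lemma ln_ennreal_ennreal: "0 < x \<Longrightarrow> ln_ennreal (ennreal x) = ereal (ln x)"
  by (simp add: ln_ennreal_def)

lemma ln_ennreal_mono: "x \<le> y \<Longrightarrow> ln_ennreal x \<le> ln_ennreal y"
  by (cases x rule: ennreal_cases; cases y rule: ennreal_cases)
    (auto simp: ln_ennreal_def top_unique)

text \<open>The hypothesis \<open>fin\<close> excludes \<infinity> - \<infinity>, which has the
  value \<infinity> in \<open>ereal\<close>. If only the second logarithm is infinite, the
  difference is -\<infinity>; \<open>y = 0\<close> is impossible as \<open>x > 0\<close>.\<close>

lemma ln_ennreal_diff_le:
  assumes x: "0 < x" and L: "0 < L" and le: "x \<le> ennreal L * y"
    and fin: "\<not> (ln_ennreal x = \<infinity> \<and> ln_ennreal y = \<infinity>)"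
  shows "ln_ennreal x - ln_ennreal y \<le> ereal (ln L)"
proof (cases y rule: ennreal_cases)
  case (real s)
  have "s > 0"
  proof (rule ccontr)
    assume "\<not> s > 0"
    then have "y = 0" using real by simp
    then show False using x le by simp
  qed
  have le': "x \<le> ennreal (L * s)"
    using le real L by (simp add: ennreal_mult)
  then obtain r where r: "x = ennreal r" "0 \<le> r"
    by (cases x rule: ennreal_cases) (auto simp: top_unique)
  then have "0 < r" using x by simp
  have "r \<le> L * s"
    using le' r L real by simp
  then have "ln r \<le> ln (L * s)"
    using \<open>0 < r\<close> by simp
  then have "ln r \<le> ln L + ln s"
    using L \<open>0 < s\<close> by (simp add: ln_mult)
  then show ?thesis
    using r real \<open>0 < r\<close> \<open>0 < s\<close> by (simp add: ln_ennreal_ennreal)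
next
  case top
  then have y: "ln_ennreal y = \<infinity>" by (simp add: ln_ennreal_def)
  then have "ln_ennreal x \<noteq> \<infinity>" using fin by simp
  then show ?thesis
    using y by (cases "ln_ennreal x") auto
qed

text \<open>Let \<open>c\<close> tend to 1 from the right. This removes the distortion factors in
  both main estimates.\<close>

lemma ennreal_le_mult_gt_1:
  fixes x y :: ennreal
  assumes "\<And>c::real. c > 1 \<Longrightarrow> x \<le> ennreal c * y"
  shows "x \<le> y"
proof (cases y rule: ennreal_cases)
  case (real s)
  have "((\<lambda>c. ennreal (c * s)) \<longlongrightarrow> ennreal (1 * s)) (at_right 1)"
    by (intro tendsto_ennrealI tendsto_mult tendsto_const tendsto_ident_at)
  moreover have "\<forall>\<^sub>F c in at_right (1::real). x \<le> ennreal (c * s)"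
    using assms real by (auto simp: eventually_at_right_less ennreal_mult
        intro!: eventually_mono[OF eventually_at_right_less])
  ultimately have "x \<le> ennreal (1 * s)"
    by (intro tendsto_lowerbound) auto
  then show ?thesis using real by simp
qed simp

lemma ennreal_scale_le_iff:
  fixes x y :: ennreal
  assumes "k > 0"
  shows "x \<le> ennreal k * y \<longleftrightarrow> ennreal (1 / k) * x \<le> y"
proof
  assume "x \<le> ennreal k * y"
  then have "ennreal (1 / k) * x \<le> ennreal (1 / k) * (ennreal k * y)"
    by (rule mult_left_mono) simp
  also have "\<dots> = y"
    using assms by (simp add: ennreal_mult[symmetric] mult.assoc[symmetric])
  finally show "ennreal (1 / k) * x \<le> y" .
next
  assume "ennreal (1 / k) * x \<le> y"
  then have "ennreal k * (ennreal (1 / k) * x) \<le> ennreal k * y"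
    by (rule mult_left_mono) simp
  moreover have "ennreal k * (ennreal (1 / k) * x) = x"
    using assms by (simp add: ennreal_mult[symmetric] mult.assoc[symmetric])
  ultimately show "x \<le> ennreal k * y" by simp
qed

text \<open>Pressure and entropy at scale \<epsilon> grow as \<epsilon> shrinks, so their limits
  exist and \<open>Lim\<close> is not an arbitrary value.\<close>

lemma Lim_at_right_0_antimono:
  fixes g :: "real \<Rightarrow> ennreal"
  assumes anti: "\<And>x y. 0 < x \<Longrightarrow> x \<le> y \<Longrightarrow> g y \<le> g x"
  shows "Lim (at_right 0) g = (SUP x\<in>{0<..}. g x)"
proof (intro tendsto_Lim order_tendstoI)
  fix b
  assume "b < (SUP x\<in>{0<..}. g x)"
  then obtain x where x: "x > 0" "b < g x"
    by (auto simp: less_SUP_iff)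
  show "\<forall>\<^sub>F y in at_right 0. b < g y"
    using eventually_at_right_real[OF x(1)]
  proof eventually_elim
    case (elim y)
    then show ?case using anti[of y x] x(2) by (auto intro: less_le_trans)
  qed
next
  fix b
  assume b: "(SUP x\<in>{0<..}. g x) < b"
  show "\<forall>\<^sub>F y in at_right 0. g y < b"
    using eventually_at_right_less[of "0::real"]
  proof eventually_elim
    case (elim y)
    then show ?case using b by (intro le_less_trans[OF SUP_upper b]) auto
  qed
qed simp

section \<open>Spanning sets, and positive functions on a compact space\<close>

lemma dyn_dist_less_iff:
  "n > 0 \<Longrightarrow> dyn_dist f n x y < \<epsilon> \<longleftrightarrow> (\<forall>i<n. dist ((f ^^ i) x) ((f ^^ i) y) < \<epsilon>)"
  unfolding dyn_dist_def by (subst Max_less_iff) auto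

lemma spanning_iff:
  "n > 0 \<Longrightarrow> spanning f S n \<epsilon> E \<longleftrightarrow>
    E \<subseteq> S \<and> (\<forall>x\<in>S. \<exists>y\<in>E. \<forall>i<n. dist ((f ^^ i) x) ((f ^^ i) y) < \<epsilon>)"
  by (simp add: spanning_def dyn_dist_less_iff)

lemma spanning_mono: "spanning f S n \<epsilon> E \<Longrightarrow> \<epsilon> \<le> \<epsilon>' \<Longrightarrow> spanning f S n \<epsilon>' E"
  unfolding spanning_def by (meson order_less_le_trans)

lemma limsup_INF_spanning_antimono:
  fixes g :: "nat \<Rightarrow> 'a::metric_space set \<Rightarrow> ennreal"
  assumes "\<epsilon> \<le> \<epsilon>'"
  shows "limsup (\<lambda>n. INF E\<in>{E. spanning f S n \<epsilon>' E}. g n E) \<le> limsup (\<lambda>n. INF E\<in>{E. spanning f S n \<epsilon> E}. g n E)"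
  using spanning_mono[OF _ assms, of f S]
  by (intro Limsup_mono always_eventually allI INF_superset_mono) auto

text \<open>Uniform continuity of \<open>ln a\<close> in exponentiated form; products over
  \<open>n\<close> steps are then distorted by at most \<open>\<kappa> ^ n\<close>.\<close>

lemma uniformly_multiplicatively_close:
  fixes a :: "'a::metric_space \<Rightarrow> real"
  assumes cpt: "compact (UNIV :: 'a set)" and a: "continuous_on UNIV a" and pos: "\<And>x. a x > 0"
    and \<kappa>: "\<kappa> > 1"
  obtains \<epsilon> where "\<epsilon> > 0" "\<And>x y. dist x y < \<epsilon> \<Longrightarrow> a x \<le> \<kappa> * a y"
proof -
  have "continuous_on UNIV (\<lambda>x. ln (a x))"
    using a pos by (intro continuous_on_ln ballI less_imp_neq[OF pos, symmetric])
  then have "uniformly_continuous_on UNIV (\<lambda>x. ln (a x))"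
    using cpt by (rule compact_uniformly_continuous)
  moreover have "ln \<kappa> > 0" using \<kappa> by simp
  ultimately obtain \<epsilon> where \<epsilon>: "\<epsilon> > 0" "\<And>x y. dist x y < \<epsilon> \<Longrightarrow> dist (ln (a x)) (ln (a y)) < ln \<kappa>"
    unfolding uniformly_continuous_on_def by (metis UNIV_I dist_commute)
  show thesis
  proof (rule that[OF \<epsilon>(1)])
    fix x y :: 'a
    assume "dist x y < \<epsilon>"
    then have "ln (a x) < ln \<kappa> + ln (a y)"
      using \<epsilon>(2)[of x y] by (simp add: dist_real_def)
    also have "\<dots> = ln (\<kappa> * a y)"
      using \<kappa> pos[of y] by (simp add: ln_mult)
    finally show "a x \<le> \<kappa> * a y"
      using pos[of x] pos[of y] \<kappa> by simp
  qed
qed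

lemma compact_positive_lower_bound:
  fixes a :: "'a::metric_space \<Rightarrow> real"
  assumes "compact (UNIV :: 'a set)" "continuous_on UNIV a" "\<And>x. a x > 0"
  obtains c where "c > 0" "\<And>x. c \<le> a x"
  using continuous_attains_inf[of "UNIV :: 'a set" a] assms by auto

subsection \<open>Pressure, forward entropy and the growth of fibers\<close>

locale essential_local_homeomorphism =
  fixes f :: "'a::metric_space \<Rightarrow> 'a" and a :: "'a \<Rightarrow> real"
  assumes cpt: "compact (UNIV :: 'a set)"
    and f: "continuous_on UNIV f"
    and lh: "local_homeomorphism_on (essential_set f) f"
    and a: "continuous_on UNIV a"
    and pos: "\<And>x. a x > 0"
begin

abbreviation fiber :: "nat \<Rightarrow> 'a \<Rightarrow> 'a set" where
  "fiber n x \<equiv> (f ^^ n) -` {x} \<inter> essential_set f"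

text \<open>Over an infinite fiber this sum would be 0; \<open>finite_fiber\<close> excludes that
  case.\<close>

definition fiber_sum :: "nat \<Rightarrow> 'a \<Rightarrow> real" where
  "fiber_sum n x = (\<Sum>y\<in>fiber n x. orbit_prod f a n y)"

text \<open>\<open>enn2real\<close> would send \<infinity> to 0; by \<open>ennreal_growth\<close>
  the supremum is finite for \<open>n > 0\<close>.\<close>

definition growth :: "nat \<Rightarrow> real" where
  "growth n = enn2real (SUP x\<in>essential_set f. root_ennreal n (ennreal (fiber_sum n x)))"

lemma orbit_pos: "orbit_prod f a n x > 0"
  by (rule orbit_prod_pos[OF pos])

lemma funpow_essential_set: "x \<in> essential_set f \<Longrightarrow> (f ^^ n) x \<in> essential_set f"
  by (induction n) (auto intro: essential_set_invariant[OF f])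

text \<open>\<epsilon> is at most half the separation constant of the fibers and at most the scale
  belonging to \<kappa>. A finite \<open>E\<close> first shows that fibers are finite; afterwards
  \<open>E\<close> may be infinite, and the fiber is compared with its finite image \<open>F\<close>
  in \<open>E\<close>.\<close>

lemma fiber_sum_comparison:
  assumes "\<kappa> > 1"
  obtains \<epsilon> where "\<epsilon> > 0" "\<And>x y. dist x y < \<epsilon> \<Longrightarrow> a x \<le> \<kappa> * a y"
    "\<And>n x E. (\<And>x. x \<in> essential_set f \<Longrightarrow> \<exists>y\<in>E. \<forall>i<n. dist ((f ^^ i) x) ((f ^^ i) y) < \<epsilon>) \<Longrightarrow>
      (finite E \<longrightarrow> finite (fiber n x)) \<and>
      (finite (fiber n x) \<longrightarrow> (\<exists>F\<subseteq>E. finite F \<and> fiber_sum n x \<le> \<kappa> ^ n * (\<Sum>y\<in>F. orbit_prod f a n y)))"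
proof -
  have "compact (essential_set f)"
    using compact_Int_closed[OF cpt closed_essential_set[of f]] by simp
  then obtain \<rho> where \<rho>: "\<rho> > 0"
    "\<And>y y'. y \<in> essential_set f \<Longrightarrow> y' \<in> essential_set f \<Longrightarrow> f y = f y' \<Longrightarrow> dist y y' < \<rho> \<Longrightarrow> y = y'"
    using separated_fibers[OF _ lh] by metis
  obtain \<epsilon>0 where \<epsilon>0: "\<epsilon>0 > 0" "\<And>x y. dist x y < \<epsilon>0 \<Longrightarrow> a x \<le> \<kappa> * a y"
    using uniformly_multiplicatively_close[OF cpt a pos assms] by metis
  define \<epsilon> where "\<epsilon> = min \<epsilon>0 (\<rho> / 2)"
  have \<epsilon>: "\<epsilon> > 0" "2 * \<epsilon> \<le> \<rho>" and near: "\<And>x y. dist x y < \<epsilon> \<Longrightarrow> a x \<le> \<kappa> * a y"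
    using \<rho>(1) \<epsilon>0 by (auto simp: \<epsilon>_def)
  show thesis
  proof (rule that[OF \<epsilon>(1) near])
    fix n x E
    assume span: "\<And>x. x \<in> essential_set f \<Longrightarrow> \<exists>y\<in>E. \<forall>i<n. dist ((f ^^ i) x) ((f ^^ i) y) < \<epsilon>"
    show "(finite E \<longrightarrow> finite (fiber n x)) \<and>
      (finite (fiber n x) \<longrightarrow> (\<exists>F\<subseteq>E. finite F \<and> fiber_sum n x \<le> \<kappa> ^ n * (\<Sum>y\<in>F. orbit_prod f a n y)))"
    proof (rule fiber_injection[where S = "essential_set f" and f = f and n = n and x = x,
        OF \<rho>(2) essential_set_invariant[OF f] \<epsilon>(2) pos near span])
      fix g
      assume inj: "inj_on g (fiber n x)" and sub: "g ` fiber n x \<subseteq> E"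
        and le: "\<And>y. y \<in> essential_set f \<Longrightarrow> orbit_prod f a n y \<le> \<kappa> ^ n * orbit_prod f a n (g y)"
      have "fiber_sum n x \<le> (\<Sum>y\<in>fiber n x. \<kappa> ^ n * orbit_prod f a n (g y))"
        unfolding fiber_sum_def by (intro sum_mono le) auto
      also have "\<dots> = \<kappa> ^ n * (\<Sum>y\<in>g ` fiber n x. orbit_prod f a n y)"
        by (simp add: sum.reindex[OF inj] sum_distrib_left)
      finally show ?thesis
        using sub inj finite_subset[OF sub] finite_imageD[OF _ inj] by blast
    qed
  qed
qed

lemma finite_fiber: "finite (fiber n x)"
proof -
  obtain \<epsilon> where \<epsilon>: "\<epsilon> > 0"
    "\<And>n x E. (\<And>x. x \<in> essential_set f \<Longrightarrow> \<exists>y\<in>E. \<forall>i<n. dist ((f ^^ i) x) ((f ^^ i) y) < \<epsilon>) \<Longrightarrow>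
      (finite E \<longrightarrow> finite (fiber n x)) \<and>
      (finite (fiber n x) \<longrightarrow> (\<exists>F\<subseteq>E. finite F \<and> fiber_sum n x \<le> 2 ^ n * (\<Sum>y\<in>F. orbit_prod f a n y)))"
    by (rule fiber_sum_comparison[of 2]) auto
  obtain E where "finite E" "\<forall>x. \<exists>y\<in>E. \<forall>i<n. dist ((f ^^ i) x) ((f ^^ i) y) < \<epsilon>"
    using ex_finite_spanning[OF cpt \<epsilon>(1)] by metis
  then show ?thesis
    using \<epsilon>(2)[of E n x] by simp
qed

lemma fiber_sum_bounded: "\<exists>B\<ge>0. \<forall>x. fiber_sum n x \<le> B"
proof -
  obtain \<epsilon> where \<epsilon>: "\<epsilon> > 0"
    "\<And>n x E. (\<And>x. x \<in> essential_set f \<Longrightarrow> \<exists>y\<in>E. \<forall>i<n. dist ((f ^^ i) x) ((f ^^ i) y) < \<epsilon>) \<Longrightarrow>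
      (finite E \<longrightarrow> finite (fiber n x)) \<and>
      (finite (fiber n x) \<longrightarrow> (\<exists>F\<subseteq>E. finite F \<and> fiber_sum n x \<le> 2 ^ n * (\<Sum>y\<in>F. orbit_prod f a n y)))"
    by (rule fiber_sum_comparison[of 2]) auto
  obtain E where E: "finite E" "\<forall>x. \<exists>y\<in>E. \<forall>i<n. dist ((f ^^ i) x) ((f ^^ i) y) < \<epsilon>"
    using ex_finite_spanning[OF cpt \<epsilon>(1)] by metis
  have "fiber_sum n x \<le> 2 ^ n * (\<Sum>y\<in>E. orbit_prod f a n y)" for x
  proof -
    obtain F where F: "F \<subseteq> E" "fiber_sum n x \<le> 2 ^ n * (\<Sum>y\<in>F. orbit_prod f a n y)"
      using \<epsilon>(2)[of E n x] E finite_fiber[of n x] by blast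
    note F(2)
    also have "2 ^ n * (\<Sum>y\<in>F. orbit_prod f a n y) \<le> 2 ^ n * (\<Sum>y\<in>E. orbit_prod f a n y)"
      by (intro mult_left_mono sum_mono2[OF E(1) F(1)] less_imp_le[OF orbit_pos]) auto
    finally show ?thesis .
  qed
  moreover have "0 \<le> 2 ^ n * (\<Sum>y\<in>E. orbit_prod f a n y)"
    by (intro mult_nonneg_nonneg sum_nonneg less_imp_le[OF orbit_pos]) auto
  ultimately show ?thesis by blast
qed

lemma growth_nonneg: "growth n \<ge> 0"
  by (simp add: growth_def)

lemma ennreal_growth:
  assumes "n > 0"
  shows "ennreal (growth n) = (SUP x\<in>essential_set f. root_ennreal n (ennreal (fiber_sum n x)))"
proof -
  obtain B where B: "B \<ge> 0" "\<And>x. fiber_sum n x \<le> B"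
    using fiber_sum_bounded by metis
  have "(SUP x\<in>essential_set f. root_ennreal n (ennreal (fiber_sum n x))) \<le> root_ennreal n (ennreal B)"
    using assms B by (intro SUP_least root_ennreal_mono ennreal_leI)
  also have "\<dots> < top"
    using B by (simp add: root_ennreal_ennreal)
  finally show ?thesis
    by (simp add: growth_def)
qed

lemma growth_le_iff:
  assumes n: "n > 0" and C: "C \<ge> 0"
  shows "growth n \<le> C \<longleftrightarrow> (\<forall>x\<in>essential_set f. fiber_sum n x \<le> C ^ n)"
proof -
  have "growth n \<le> C \<longleftrightarrow> ennreal (growth n) \<le> ennreal C"
    using C by simp
  also have "\<dots> \<longleftrightarrow> (\<forall>x\<in>essential_set f. ennreal (fiber_sum n x) \<le> ennreal C ^ n)"
    unfolding ennreal_growth[OF n] SUP_le_iff root_ennreal_le_iff[OF n] ..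
  finally show ?thesis
    using C by (simp add: ennreal_power)
qed

lemma fiber_sum_le_growth: "n > 0 \<Longrightarrow> x \<in> essential_set f \<Longrightarrow> fiber_sum n x \<le> growth n ^ n"
  using growth_le_iff[of n "growth n"] growth_nonneg by blast

text \<open>The fiber of \<open>f ^^ (m + n)\<close> over \<open>x\<close> splits into the fibers of
  \<open>f ^^ m\<close> over the points of \<open>fiber n x\<close>, and the orbit product factors
  accordingly.\<close>

lemma growth_submultiplicative:
  assumes m: "m > 0" and n: "n > 0"
  shows "growth (m + n) ^ (m + n) \<le> growth m ^ m * growth n ^ n"
proof -
  define D where "D = growth m ^ m * growth n ^ n"
  have D: "D \<ge> 0" by (simp add: D_def growth_nonneg)
  have "fiber_sum (m + n) x \<le> D" if x: "x \<in> essential_set f" for x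
  proof -
    have sub: "(f ^^ m) ` fiber (m + n) x \<subseteq> fiber n x"
      by (auto simp: funpow_essential_set funpow_add add.commute[of m n])
    have eq: "{y \<in> fiber (m + n) x. (f ^^ m) y = z} = fiber m z" if "z \<in> fiber n x" for z
      using that by (auto simp: funpow_add add.commute[of m n])
    have "fiber_sum (m + n) x = (\<Sum>z\<in>fiber n x. \<Sum>y\<in>fiber m z. orbit_prod f a (m + n) y)"
      unfolding fiber_sum_def sum.group[OF finite_fiber finite_fiber sub, symmetric]
      by (intro sum.cong refl) (use eq in simp)
    also have "\<dots> = (\<Sum>z\<in>fiber n x. fiber_sum m z * orbit_prod f a n z)"
      unfolding fiber_sum_def by (auto simp: orbit_prod_add sum_distrib_right intro!: sum.cong)
    also have "\<dots> \<le> (\<Sum>z\<in>fiber n x. growth m ^ m * orbit_prod f a n z)"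
      using m by (intro sum_mono mult_right_mono fiber_sum_le_growth less_imp_le[OF orbit_pos]) auto
    also have "\<dots> = growth m ^ m * fiber_sum n x"
      by (simp add: fiber_sum_def sum_distrib_left)
    also have "\<dots> \<le> D"
      unfolding D_def using n x growth_nonneg by (intro mult_left_mono fiber_sum_le_growth) auto
    finally show ?thesis .
  qed
  then have "growth (m + n) \<le> root (m + n) D"
    using m D by (subst growth_le_iff) auto
  then have "growth (m + n) ^ (m + n) \<le> root (m + n) D ^ (m + n)"
    by (intro power_mono growth_nonneg)
  then show ?thesis
    using m D by (simp add: D_def)
qed

text \<open>Convergence comes from Fekete's lemma and ensures that \<open>lim\<close> in the
  definition of the potential has its intended value.\<close>

lemma growth_limit:
  obtains L where "growth \<longlonglongrightarrow> L" "L > 0"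
    "essential_spectral_potential f a = ln_ennreal (ennreal L)"
proof -
  obtain L where L: "growth \<longlonglongrightarrow> L"
    using fekete_root[OF growth_nonneg growth_submultiplicative] by (auto simp: convergent_def)
  obtain c where c: "c > 0" "\<And>x. c \<le> a x"
    using compact_positive_lower_bound[OF cpt a pos] by metis
  obtain y where y: "y \<in> essential_set f"
    using essential_set_nonempty[OF cpt f] by auto
  \<comment> \<open>\<open>y\<close> itself lies in the fiber over \<open>(f ^^ n) y\<close>, so the
    lower bound \<open>c\<close> of \<open>a\<close> passes to \<open>growth n\<close> and keeps the
    limit positive.\<close>
  have "c \<le> growth n" if n: "n > 0" for n
  proof -
    have "c ^ n = (\<Prod>i<n. c)" by simp
    also have "\<dots> \<le> orbit_prod f a n y"
      unfolding orbit_prod_def using c by (intro prod_mono) (auto intro: less_imp_le)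
    also have "\<dots> \<le> fiber_sum n ((f ^^ n) y)"
      unfolding fiber_sum_def using y by (intro member_le_sum finite_fiber less_imp_le[OF orbit_pos]) auto
    also have "\<dots> \<le> growth n ^ n"
      using n y by (intro fiber_sum_le_growth funpow_essential_set)
    finally show ?thesis
      using n c growth_nonneg[of n] by (simp add: power_mono_iff)
  qed
  then have "c \<le> L"
    by (intro LIMSEQ_le_const[OF L]) (auto intro: exI[of _ 1])
  then have "L > 0" using c by simp
  have "(\<lambda>n. ennreal (growth n)) \<longlonglongrightarrow> ennreal L"
    by (intro tendsto_ennrealI L)
  moreover have "\<forall>\<^sub>F n in sequentially. ennreal (growth n) = (SUP x\<in>essential_set f.
      root_ennreal n (\<Sum>\<^sub>\<infinity>y\<in>fiber n x. ennreal (orbit_prod f a n y)))"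
    using eventually_gt_at_top[of 0]
  proof eventually_elim
    case (elim n)
    have "(\<Sum>\<^sub>\<infinity>y\<in>fiber n x. ennreal (orbit_prod f a n y)) = ennreal (fiber_sum n x)" for x
      using finite_fiber[of n x] by (simp add: fiber_sum_def less_imp_le[OF orbit_pos])
    then show ?case
      using ennreal_growth[OF elim] by simp
  qed
  ultimately have "(\<lambda>n. SUP x\<in>essential_set f.
      root_ennreal n (\<Sum>\<^sub>\<infinity>y\<in>fiber n x. ennreal (orbit_prod f a n y))) \<longlonglongrightarrow> ennreal L"
    by (rule Lim_transform_eventually)
  then have "essential_spectral_potential f a = ln_ennreal (ennreal L)"
    unfolding essential_spectral_potential_def by (simp add: limI)
  then show thesis
    using that L \<open>L > 0\<close> by blast
qed

section \<open>Comparison of pressure and entropy at a fixed scale\<close>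

definition pressure_at :: "real \<Rightarrow> ennreal" where
  "pressure_at \<epsilon> = limsup (\<lambda>n. INF E\<in>{E. spanning f UNIV n \<epsilon> E}.
     root_ennreal n (\<Sum>\<^sub>\<infinity>y\<in>E. ennreal (orbit_prod f a n y)))"

definition entropy_at :: "real \<Rightarrow> ennreal" where
  "entropy_at \<epsilon> = limsup (\<lambda>n. INF E\<in>{E. spanning f (essential_set f) n \<epsilon> E}.
     root_ennreal n (emeasure (count_space UNIV) ((f ^^ n) ` E)))"

lemma pressure_eq: "pressure f a = ln_ennreal (SUP \<epsilon>\<in>{0<..}. pressure_at \<epsilon>)"
  unfolding pressure_def pressure_at_def
  by (subst Lim_at_right_0_antimono) (auto intro: limsup_INF_spanning_antimono)

lemma forward_entropy_eq: "forward_entropy f = ln_ennreal (SUP \<epsilon>\<in>{0<..}. entropy_at \<epsilon>)"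
  unfolding forward_entropy_def entropy_at_def
  by (subst Lim_at_right_0_antimono) (auto intro: limsup_INF_spanning_antimono)

text \<open>A fiber injects into each spanning set of the whole space at the cost of
  \<open>\<kappa> ^ n\<close>. One scale depending on \<kappa> suffices, since the supremum over
  scales dominates the value there.\<close>

lemma growth_limit_le_pressure:
  assumes L: "growth \<longlonglongrightarrow> L"
  shows "ennreal L \<le> (SUP \<epsilon>\<in>{0<..}. pressure_at \<epsilon>)"
proof (rule ennreal_le_mult_gt_1)
  fix \<kappa> :: real
  assume \<kappa>: "\<kappa> > 1"
  obtain \<epsilon> where \<epsilon>: "\<epsilon> > 0"
    "\<And>n x E. (\<And>x. x \<in> essential_set f \<Longrightarrow> \<exists>y\<in>E. \<forall>i<n. dist ((f ^^ i) x) ((f ^^ i) y) < \<epsilon>) \<Longrightarrow>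
      (finite E \<longrightarrow> finite (fiber n x)) \<and>
      (finite (fiber n x) \<longrightarrow> (\<exists>F\<subseteq>E. finite F \<and> fiber_sum n x \<le> \<kappa> ^ n * (\<Sum>y\<in>F. orbit_prod f a n y)))"
    by (rule fiber_sum_comparison[OF \<kappa>]) auto
  let ?p = "\<lambda>n. INF E\<in>{E. spanning f UNIV n \<epsilon> E}.
     root_ennreal n (\<Sum>\<^sub>\<infinity>y\<in>E. ennreal (orbit_prod f a n y))"
  have le: "ennreal (growth n) \<le> ennreal \<kappa> * root_ennreal n (\<Sum>\<^sub>\<infinity>y\<in>E. ennreal (orbit_prod f a n y))"
    if n: "n > 0" and E: "spanning f UNIV n \<epsilon> E" for n E
    unfolding ennreal_growth[OF n]
  proof (rule SUP_least)
    fix x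
    let ?s = "\<Sum>\<^sub>\<infinity>y\<in>E. ennreal (orbit_prod f a n y)"
    obtain F where F: "F \<subseteq> E" "finite F" "fiber_sum n x \<le> \<kappa> ^ n * (\<Sum>y\<in>F. orbit_prod f a n y)"
      using \<epsilon>(2)[of E n x] E finite_fiber[of n x] by (auto simp: spanning_iff[OF n])
    have "ennreal (fiber_sum n x) \<le> ennreal (\<kappa> ^ n * (\<Sum>y\<in>F. orbit_prod f a n y))"
      by (rule ennreal_leI[OF F(3)])
    also have "\<dots> = ennreal \<kappa> ^ n * (\<Sum>y\<in>F. ennreal (orbit_prod f a n y))"
      using \<kappa> by (simp add: ennreal_mult ennreal_power sum_nonneg less_imp_le[OF orbit_pos])
    also have "(\<Sum>y\<in>F. ennreal (orbit_prod f a n y)) = (\<Sum>\<^sub>\<infinity>y\<in>F. ennreal (orbit_prod f a n y))"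
      using F(2) by simp
    also have "\<dots> \<le> ?s"
      using F(1) by (intro infsum_mono_neutral nonneg_summable_on_complete) auto
    also have "?s \<le> root_ennreal n ?s ^ n"
      by (rule le_root_ennreal_power[OF n])
    finally have "ennreal (fiber_sum n x) \<le> (ennreal \<kappa> * root_ennreal n ?s) ^ n"
      by (simp add: mult_left_mono power_mult_distrib)
    then show "root_ennreal n (ennreal (fiber_sum n x)) \<le> ennreal \<kappa> * root_ennreal n ?s"
      by (simp add: root_ennreal_le_iff[OF n])
  qed
  \<comment> \<open>The factor \<kappa> moves to the left side, so that the infimum over
    \<open>E\<close> can be taken on the right.\<close>
  have "ennreal (1 / \<kappa> * growth n) \<le> ?p n" if "n > 0" for n
  proof -
    have "ennreal (1 / \<kappa> * growth n) = ennreal (1 / \<kappa>) * ennreal (growth n)"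
      using \<kappa> growth_nonneg by (intro ennreal_mult) auto
    also have "\<dots> \<le> ?p n"
      using le[OF that] \<kappa> by (intro INF_greatest) (simp add: ennreal_scale_le_iff)
    finally show ?thesis .
  qed
  then have "\<forall>\<^sub>F n in sequentially. ennreal (1 / \<kappa> * growth n) \<le> ?p n"
    by (intro eventually_mono[OF eventually_gt_at_top[of 0]])
  then have "limsup (\<lambda>n. ennreal (1 / \<kappa> * growth n)) \<le> limsup ?p"
    by (rule Limsup_mono)
  moreover have "(\<lambda>n. ennreal (1 / \<kappa> * growth n)) \<longlonglongrightarrow> ennreal (1 / \<kappa> * L)"
    by (intro tendsto_ennrealI tendsto_mult tendsto_const L)
  then have "limsup (\<lambda>n. ennreal (1 / \<kappa> * growth n)) = ennreal (1 / \<kappa> * L)"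
    by (intro lim_imp_Limsup) auto
  moreover have "L \<ge> 0"
    using L growth_nonneg by (intro LIMSEQ_le_const) auto
  ultimately have "ennreal (1 / \<kappa>) * ennreal L \<le> pressure_at \<epsilon>"
    using \<kappa> by (simp add: pressure_at_def flip: ennreal_mult)
  also have "\<dots> \<le> (SUP \<epsilon>\<in>{0<..}. pressure_at \<epsilon>)"
    using \<epsilon>(1) by (intro SUP_upper) auto
  finally show "ennreal L \<le> ennreal \<kappa> * (SUP \<epsilon>\<in>{0<..}. pressure_at \<epsilon>)"
    using \<kappa> by (subst ennreal_scale_le_iff) auto
qed

text \<open>\<open>E\<close> is grouped by its image under \<open>f ^^ n\<close>, each group lying
  in one fiber. Through the cardinality of the image the forward entropy enters.\<close>

lemma spanning_sum_le_card_image: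
  assumes n: "n > 0" and E: "E \<subseteq> essential_set f" and fin: "finite ((f ^^ n) ` E)"
  shows "finite E" "(\<Sum>y\<in>E. orbit_prod f a n y) \<le> real (card ((f ^^ n) ` E)) * growth n ^ n"
proof -
  let ?Z = "(f ^^ n) ` E"
  have "E \<subseteq> (\<Union>z\<in>?Z. fiber n z)"
    using E by auto
  then show finE: "finite E"
    using fin finite_fiber by (meson finite_UN_I finite_subset)
  have "(\<Sum>y\<in>E. orbit_prod f a n y) = (\<Sum>z\<in>?Z. \<Sum>y\<in>{y\<in>E. (f ^^ n) y = z}. orbit_prod f a n y)"
    by (rule sum.group[OF finE fin subset_refl, symmetric])
  also have "\<dots> \<le> (\<Sum>z\<in>?Z. growth n ^ n)"
  proof (rule sum_mono)
    fix z
    assume z: "z \<in> ?Z"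
    have "(\<Sum>y\<in>{y\<in>E. (f ^^ n) y = z}. orbit_prod f a n y) \<le> fiber_sum n z"
      unfolding fiber_sum_def using E by (intro sum_mono2 finite_fiber less_imp_le[OF orbit_pos]) auto
    also have "\<dots> \<le> growth n ^ n"
      using z E n funpow_essential_set by (intro fiber_sum_le_growth) auto
    finally show "(\<Sum>y\<in>{y\<in>E. (f ^^ n) y = z}. orbit_prod f a n y) \<le> growth n ^ n" .
  qed
  finally show "(\<Sum>y\<in>E. orbit_prod f a n y) \<le> real (card ?Z) * growth n ^ n"
    by simp
qed

text \<open>\<open>E\<close> spans only the essential set, at the single time \<open>m\<close>, yet
  it bounds the pressure of the whole space; the constant from
  \<open>eventually_spanning_sum_le\<close> disappears under the \<open>n\<close>-th root.\<close>

lemma pressure_at_le: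
  assumes \<kappa>: "\<kappa> > 1" and \<epsilon>: "\<epsilon> > 0" and near: "\<And>x y. dist x y < \<epsilon> \<Longrightarrow> a x \<le> \<kappa> * a y"
    and m: "m > 0" and E: "spanning f (essential_set f) m \<epsilon> E" "finite E"
  shows "pressure_at (2 * \<epsilon>) \<le> ennreal (\<kappa> ^ 3 * root m (\<Sum>y\<in>E. orbit_prod f a m y))"
proof -
  define q where "q = \<kappa> ^ 3 * root m (\<Sum>y\<in>E. orbit_prod f a m y)"
  have q: "q \<ge> 0"
    unfolding q_def using \<kappa> m
    by (intro mult_nonneg_nonneg real_root_ge_zero sum_nonneg less_imp_le[OF orbit_pos]) auto
  have span: "\<exists>y\<in>E. \<forall>i<m. dist ((f ^^ i) x) ((f ^^ i) y) < \<epsilon>" if "x \<in> essential_set f" for x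
    using E(1) that by (simp add: spanning_iff[OF m])
  obtain C where C: "C > 0" "\<forall>\<^sub>F n in sequentially. \<exists>E'. finite E'
    \<and> (\<forall>x. \<exists>y\<in>E'. \<forall>i<n. dist ((f ^^ i) x) ((f ^^ i) y) < 2 * \<epsilon>)
    \<and> (\<Sum>y\<in>E'. orbit_prod f a n y) \<le> C * q ^ n"
    unfolding q_def by (rule eventually_spanning_sum_le[OF cpt f pos \<epsilon> \<kappa> near m E(2) span])
  have "\<forall>\<^sub>F n in sequentially. (INF E\<in>{E. spanning f UNIV n (2 * \<epsilon>) E}.
     root_ennreal n (\<Sum>\<^sub>\<infinity>y\<in>E. ennreal (orbit_prod f a n y))) \<le> ennreal (root n C * q)"
    using C(2) eventually_gt_at_top[of 0]
  proof eventually_elim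
    case (elim n)
    then obtain E' where E': "finite E'" "spanning f UNIV n (2 * \<epsilon>) E'"
      "(\<Sum>y\<in>E'. orbit_prod f a n y) \<le> C * q ^ n"
      by (auto simp: spanning_iff)
    have "(\<Sum>\<^sub>\<infinity>y\<in>E'. ennreal (orbit_prod f a n y)) = ennreal (\<Sum>y\<in>E'. orbit_prod f a n y)"
      using E'(1) by (simp add: less_imp_le[OF orbit_pos])
    also have "\<dots> \<le> ennreal (C * q ^ n)"
      by (rule ennreal_leI[OF E'(3)])
    finally have "root_ennreal n (\<Sum>\<^sub>\<infinity>y\<in>E'. ennreal (orbit_prod f a n y)) \<le> root_ennreal n (ennreal (C * q ^ n))"
      by (rule root_ennreal_mono[OF elim(2)])
    also have "\<dots> = ennreal (root n C * q)"
      using C(1) q elim(2) by (simp add: root_ennreal_ennreal real_root_mult real_root_power_cancel)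
    finally show ?case
      using E'(2) by (intro INF_lower2[of E']) auto
  qed
  then have "pressure_at (2 * \<epsilon>) \<le> limsup (\<lambda>n. ennreal (root n C * q))"
    unfolding pressure_at_def by (rule Limsup_mono)
  also have "(\<lambda>n. ennreal (root n C * q)) \<longlonglongrightarrow> ennreal (1 * q)"
    by (intro tendsto_ennrealI tendsto_mult tendsto_const LIMSEQ_root_const C(1))
  then have "limsup (\<lambda>n. ennreal (root n C * q)) = ennreal q"
    using lim_imp_Limsup[of sequentially] by simp
  finally show ?thesis
    by (simp add: q_def)
qed

lemma pressure_le_growth_limit:
  assumes L: "growth \<longlonglongrightarrow> L" "L > 0"
  shows "(SUP \<epsilon>\<in>{0<..}. pressure_at \<epsilon>) \<le> ennreal L * (SUP \<epsilon>\<in>{0<..}. entropy_at \<epsilon>)"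
proof (rule ennreal_le_mult_gt_1)
  fix c :: real
  assume c: "c > 1"
  \<comment> \<open>Of the four factors \<kappa>, three come from \<open>pressure_at_le\<close> and
    one from \<open>growth n < \<kappa> * L\<close>.\<close>
  define \<kappa> where "\<kappa> = root 4 c"
  have \<kappa>: "\<kappa> > 1" "\<kappa> ^ 4 = c"
    using c by (auto simp: \<kappa>_def)
  obtain \<epsilon>0 where \<epsilon>0: "\<epsilon>0 > 0" "\<And>x y. dist x y < \<epsilon>0 \<Longrightarrow> a x \<le> \<kappa> * a y"
    using uniformly_multiplicatively_close[OF cpt a pos \<kappa>(1)] by metis
  have "pressure_at \<epsilon>' \<le> ennreal (c * L) * (SUP \<epsilon>\<in>{0<..}. entropy_at \<epsilon>)" if \<epsilon>': "\<epsilon>' > 0" for \<epsilon>'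
  proof -
    define \<epsilon> where "\<epsilon> = min \<epsilon>0 (\<epsilon>' / 2)"
    have \<epsilon>: "\<epsilon> > 0" "2 * \<epsilon> \<le> \<epsilon>'" and near: "\<And>x y. dist x y < \<epsilon> \<Longrightarrow> a x \<le> \<kappa> * a y"
      using \<epsilon>0 \<epsilon>' by (auto simp: \<epsilon>_def)
    have le: "pressure_at (2 * \<epsilon>) \<le> ennreal (c * L) * root_ennreal n (emeasure (count_space UNIV) ((f ^^ n) ` E))"
      if n: "n > 0" and grow: "growth n < \<kappa> * L" and E: "spanning f (essential_set f) n \<epsilon> E" for n E
    proof (cases "finite ((f ^^ n) ` E)")
      case True
      let ?N = "real (card ((f ^^ n) ` E))"
      have sub: "E \<subseteq> essential_set f"
        using E by (simp add: spanning_def)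
      note fin = spanning_sum_le_card_image[OF n sub True]
      have "root n (\<Sum>y\<in>E. orbit_prod f a n y) \<le> root n (?N * growth n ^ n)"
        using n fin(2) by simp
      also have "\<dots> = root n ?N * growth n"
        using n growth_nonneg by (simp add: real_root_mult real_root_power_cancel)
      also have "\<dots> \<le> root n ?N * (\<kappa> * L)"
        using grow n by (intro mult_left_mono) auto
      finally have "\<kappa> ^ 3 * root n (\<Sum>y\<in>E. orbit_prod f a n y) \<le> \<kappa> ^ 3 * (root n ?N * (\<kappa> * L))"
        using \<kappa> by (intro mult_left_mono) auto
      also have "\<dots> = c * L * root n ?N"
        unfolding \<kappa>(2)[symmetric] by (simp add: eval_nat_numeral)
      finally have "pressure_at (2 * \<epsilon>) \<le> ennreal (c * L * root n ?N)"
        using pressure_at_le[OF \<kappa>(1) \<epsilon>(1) near n E fin(1)] by (meson ennreal_leI order_trans)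
      also have "\<dots> = ennreal (c * L) * root_ennreal n (ennreal ?N)"
        using c L n by (subst ennreal_mult) (auto simp: root_ennreal_ennreal)
      finally show ?thesis
        using True by (simp add: emeasure_count_space ennreal_of_nat_eq_real_of_nat)
    next
      case False
      \<comment> \<open>An infinite image makes the right side \<infinity>, as \<open>c * L\<close>
        is positive.\<close>
      then have "root_ennreal n (emeasure (count_space UNIV) ((f ^^ n) ` E)) = top"
        by (simp add: root_ennreal_def)
      then show ?thesis
        using c L by (simp add: ennreal_mult_top)
    qed
    have cL: "c * L > 0" using c L by simp
    have "L < \<kappa> * L"
      using \<kappa> L by simp
    then have "\<forall>\<^sub>F n in sequentially. growth n < \<kappa> * L"
      using L(1) by (simp add: order_tendsto_iff)
    \<comment> \<open>The left side is independent of \<open>n\<close>, so a bound for all large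
      \<open>n\<close> passes to the limes superior.\<close>
    then have "\<forall>\<^sub>F n in sequentially. ennreal (1 / (c * L)) * pressure_at (2 * \<epsilon>) \<le>
        (INF E\<in>{E. spanning f (essential_set f) n \<epsilon> E}.
          root_ennreal n (emeasure (count_space UNIV) ((f ^^ n) ` E)))"
      using eventually_gt_at_top[of 0]
    proof eventually_elim
      case (elim n)
      show ?case
        by (intro INF_greatest) (use le[OF elim(2,1)] ennreal_scale_le_iff[OF cL] in auto)
    qed
    then have "ennreal (1 / (c * L)) * pressure_at (2 * \<epsilon>) \<le> entropy_at \<epsilon>"
      unfolding entropy_at_def by (intro le_Limsup) auto
    also have "\<dots> \<le> (SUP \<epsilon>\<in>{0<..}. entropy_at \<epsilon>)"
      using \<epsilon>(1) by (intro SUP_upper) auto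
    finally have "pressure_at (2 * \<epsilon>) \<le> ennreal (c * L) * (SUP \<epsilon>\<in>{0<..}. entropy_at \<epsilon>)"
      by (simp only: ennreal_scale_le_iff[OF cL])
    moreover have "pressure_at \<epsilon>' \<le> pressure_at (2 * \<epsilon>)"
      unfolding pressure_at_def by (rule limsup_INF_spanning_antimono[OF \<epsilon>(2)])
    ultimately show ?thesis by simp
  qed
  then have "(SUP \<epsilon>\<in>{0<..}. pressure_at \<epsilon>) \<le> ennreal (c * L) * (SUP \<epsilon>\<in>{0<..}. entropy_at \<epsilon>)"
    by (intro SUP_least) auto
  then show "(SUP \<epsilon>\<in>{0<..}. pressure_at \<epsilon>) \<le> ennreal c * (ennreal L * (SUP \<epsilon>\<in>{0<..}. entropy_at \<epsilon>))"
    using c L by (simp add: ennreal_mult mult.assoc)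
qed

end

theorem theorem9:
  fixes \<alpha> :: "'a::metric_space \<Rightarrow> 'a" and a :: "'a \<Rightarrow> real"
  assumes "compact (UNIV :: 'a set)"
    and "continuous_on UNIV \<alpha>"
    and "local_homeomorphism_on (essential_set \<alpha>) \<alpha>"
    and "continuous_on UNIV a"
    and "\<And>x. a x > 0"
  shows "(\<not> (pressure \<alpha> a = \<infinity> \<and> forward_entropy \<alpha> = \<infinity>) \<longrightarrow>
            pressure \<alpha> a - forward_entropy \<alpha> \<le> essential_spectral_potential \<alpha> a)
         \<and> essential_spectral_potential \<alpha> a \<le> pressure \<alpha> a"
proof -
  interpret essential_local_homeomorphism \<alpha> a
    by unfold_locales (fact assms)+
  obtain L where L: "growth \<longlonglongrightarrow> L" "L > 0"
    and pot: "essential_spectral_potential \<alpha> a = ln_ennreal (ennreal L)"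
    by (rule growth_limit)
  have lower: "ennreal L \<le> (SUP \<epsilon>\<in>{0<..}. pressure_at \<epsilon>)"
    by (rule growth_limit_le_pressure[OF L(1)])
  \<comment> \<open>\<open>ln_ennreal_diff_le\<close> asks for this positivity, which excludes the
    value \<open>ln 0\<close>.\<close>
  then have "0 < (SUP \<epsilon>\<in>{0<..}. pressure_at \<epsilon>)"
    using L(2) by (meson ennreal_less_zero_iff less_le_trans)
  then show ?thesis
    using ln_ennreal_mono[OF lower] ln_ennreal_diff_le[OF _ L(2) pressure_le_growth_limit[OF L]]
    unfolding pot pressure_eq forward_entropy_eq ln_ennreal_ennreal[OF L(2)] by blast
qed

end
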